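(* The category of 2-skeletal Chermak partial groups is equivalent to the category of binary partial groups.
   Context: **Notation.** For expressions $a,b$ which may or may not be defined, $a \asymp b$ means that either both are undefined, or both are defined and $a=b$. **Binary partial groups.** A unital partial magma is a set $P$ with a partially defined binary operation $P\times P \nrightarrow P$, written $(a,b)\mapsto ab$, and an element $1\in P$ such that $a1\asymp a\asymp 1a$ for all $a\in P$. A binary partial group is a unital partial magma $P$ such that for each $a\in P$ there exists $a^\dagger\in P$ satisfying both of the following for all $b\in P$: (1) if $ab$ is defined then $a^\dagger(ab)\asymp b$; (2) if $ba$ is defined then $(ba)a^\dagger\asymp b$. A map of binary partial groups $f\colon P\to Q$ is a (total) function such that whenever $ab$ is defined in $P$, the product $f(a)f(b)$ is defined in $Q$ and $f(ab)=f(a)f(b)$. (Such a map automatically preserves units and inverses.) **Chermak partial groups.** Let $\Upsilon$ be the category with objects $[n]=\{0,1,\dots,n\}$, $n\ge 0$, and morphisms all functions. A symmetric set is a functor $X\colon \Upsilon^{\mathrm{op}}\to \mathsf{Set}$, with $X_n := X([n])$; morphisms are natural transformations. The Segal map $\mathscr{E}_n\colon X_n\to X_1^{\times n}$ is the map whose $i$-th component ($1\le i\le n$) is induced by $[1]\to[n]$, $0\mapsto i-1$, $1\mapsto i$. A symmetric set $X$ is spiny if $\mathscr{E}_n$ is injective for all $n\ge 2$, and reduced if $X_0$ is a one-point set. A (Chermak) partial group is a reduced spiny symmetric set; partial groups form a full subcategory of symmetric sets. **2-skeletal.** The 2-skeleton $\operatorname{sk}_2X$ of a symmetric set $X$ is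 the smallest symmetric subset of $X$ containing all of $X_0$, $X_1$ and $X_2$. A symmetric set $X$ is 2-skeletal if $\operatorname{sk}_2X=X$. The category of 2-skeletal Chermak partial groups is the full subcategory of Chermak partial groups on those that are 2-skeletal. *)

theory Defs
  imports Main "HOL-Library.FuncSet"
begin

section \<open>Categories\<close>

text \<open>
  Hom-sets need not be disjoint: a morphism is always considered together with its source
  and target, and composition takes the three objects involved as arguments.
  \<^term>\<open>Comp C X Y Z g f\<close> is the composite of \<open>f : X \<rightarrow> Y\<close> followed by \<open>g : Y \<rightarrow> Z\<close>.
\<close>

record ('o, 'm) cat =
  Ob :: "'o set"
  Hom :: "'o \<Rightarrow> 'o \<Rightarrow> 'm set"
  Ident :: "'o \<Rightarrow> 'm"
  Comp :: "'o \<Rightarrow> 'o \<Rightarrow> 'o \<Rightarrow> 'm \<Rightarrow> 'm \<Rightarrow> 'm"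

locale category =
  fixes C :: "('o, 'm) cat"
  assumes ident_hom: "X \<in> Ob C \<Longrightarrow> Ident C X \<in> Hom C X X"
    and comp_hom: "\<lbrakk>X \<in> Ob C; Y \<in> Ob C; Z \<in> Ob C; f \<in> Hom C X Y; g \<in> Hom C Y Z\<rbrakk>
      \<Longrightarrow> Comp C X Y Z g f \<in> Hom C X Z"
    and ident_left: "\<lbrakk>X \<in> Ob C; Y \<in> Ob C; f \<in> Hom C X Y\<rbrakk> \<Longrightarrow> Comp C X Y Y (Ident C Y) f = f"
    and ident_right: "\<lbrakk>X \<in> Ob C; Y \<in> Ob C; f \<in> Hom C X Y\<rbrakk> \<Longrightarrow> Comp C X X Y f (Ident C X) = f"
    and comp_assoc: "\<lbrakk>W \<in> Ob C; X \<in> Ob C; Y \<in> Ob C; Z \<in> Ob C;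
        f \<in> Hom C W X; g \<in> Hom C X Y; h \<in> Hom C Y Z\<rbrakk>
      \<Longrightarrow> Comp C W Y Z h (Comp C W X Y g f) = Comp C W X Z (Comp C X Y Z h g) f"

definition isomorphism :: "('o, 'm) cat \<Rightarrow> 'o \<Rightarrow> 'o \<Rightarrow> 'm \<Rightarrow> bool" where
  "isomorphism C X Y f \<longleftrightarrow> f \<in> Hom C X Y \<and>
    (\<exists>g \<in> Hom C Y X. Comp C X Y X g f = Ident C X \<and> Comp C Y X Y f g = Ident C Y)"

definition opposite :: "('o, 'm) cat \<Rightarrow> ('o, 'm) cat" where
  "opposite C = \<lparr>Ob = Ob C, Hom = (\<lambda>X Y. Hom C Y X), Ident = Ident C,
    Comp = (\<lambda>X Y Z g f. Comp C Z Y X f g)\<rparr>"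

definition full_subcategory :: "('o, 'm) cat \<Rightarrow> ('o \<Rightarrow> bool) \<Rightarrow> ('o, 'm) cat" where
  "full_subcategory C p = C\<lparr>Ob := {X \<in> Ob C. p X}\<rparr>"

record ('o, 'm, 'p, 'n) cfunctor =
  fob :: "'o \<Rightarrow> 'p"
  fmor :: "'o \<Rightarrow> 'o \<Rightarrow> 'm \<Rightarrow> 'n"

locale is_functor = C: category C + D: category D
  for C :: "('o, 'm) cat" and D :: "('p, 'n) cat" +
  fixes F :: "('o, 'm, 'p, 'n) cfunctor"
  assumes fob_ob: "X \<in> Ob C \<Longrightarrow> fob F X \<in> Ob D"
    and fmor_hom: "\<lbrakk>X \<in> Ob C; Y \<in> Ob C; f \<in> Hom C X Y\<rbrakk>
      \<Longrightarrow> fmor F X Y f \<in> Hom D (fob F X) (fob F Y)"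
    and fmor_ident: "X \<in> Ob C \<Longrightarrow> fmor F X X (Ident C X) = Ident D (fob F X)"
    and fmor_comp: "\<lbrakk>X \<in> Ob C; Y \<in> Ob C; Z \<in> Ob C; f \<in> Hom C X Y; g \<in> Hom C Y Z\<rbrakk>
      \<Longrightarrow> fmor F X Z (Comp C X Y Z g f) =
        Comp D (fob F X) (fob F Y) (fob F Z) (fmor F Y Z g) (fmor F X Y f)"

definition id_functor :: "('o, 'm, 'o, 'm) cfunctor" where
  "id_functor = \<lparr>fob = (\<lambda>X. X), fmor = (\<lambda>X Y f. f)\<rparr>"

definition comp_functor ::
  "('p, 'n, 'q, 'k) cfunctor \<Rightarrow> ('o, 'm, 'p, 'n) cfunctor \<Rightarrow> ('o, 'm, 'q, 'k) cfunctor" where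
  "comp_functor G F = \<lparr>fob = (\<lambda>X. fob G (fob F X)),
    fmor = (\<lambda>X Y f. fmor G (fob F X) (fob F Y) (fmor F X Y f))\<rparr>"

definition natural_transformation ::
  "('o, 'm) cat \<Rightarrow> ('p, 'n) cat \<Rightarrow> ('o, 'm, 'p, 'n) cfunctor \<Rightarrow> ('o, 'm, 'p, 'n) cfunctor
    \<Rightarrow> ('o \<Rightarrow> 'n) \<Rightarrow> bool" where
  "natural_transformation C D F G t \<longleftrightarrow>
    is_functor C D F \<and> is_functor C D G \<and>
    (\<forall>X \<in> Ob C. t X \<in> Hom D (fob F X) (fob G X)) \<and>
    (\<forall>X \<in> Ob C. \<forall>Y \<in> Ob C. \<forall>f \<in> Hom C X Y.
      Comp D (fob F X) (fob F Y) (fob G Y) (t Y) (fmor F X Y f) =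
      Comp D (fob F X) (fob G X) (fob G Y) (fmor G X Y f) (t X))"

definition natural_isomorphism ::
  "('o, 'm) cat \<Rightarrow> ('p, 'n) cat \<Rightarrow> ('o, 'm, 'p, 'n) cfunctor \<Rightarrow> ('o, 'm, 'p, 'n) cfunctor
    \<Rightarrow> ('o \<Rightarrow> 'n) \<Rightarrow> bool" where
  "natural_isomorphism C D F G t \<longleftrightarrow> natural_transformation C D F G t \<and>
    (\<forall>X \<in> Ob C. isomorphism D (fob F X) (fob G X) (t X))"

definition equivalent_categories :: "('o, 'm) cat \<Rightarrow> ('p, 'n) cat \<Rightarrow> bool" where
  "equivalent_categories C D \<longleftrightarrow>
    (\<exists>F G \<eta> \<epsilon>. is_functor C D F \<and> is_functor D C G \<and>
      natural_isomorphism C C id_functor (comp_functor G F) \<eta> \<and>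
      natural_isomorphism D D (comp_functor F G) id_functor \<epsilon>)"

text \<open>
  The extensionality conditions fix the irrelevant values outside of objects and hom-sets, so
  that equal objects and morphisms of the functor category are equal HOL terms.
\<close>

definition functor_category ::
  "('o, 'm) cat \<Rightarrow> ('p, 'n) cat \<Rightarrow> (('o, 'm, 'p, 'n) cfunctor, 'o \<Rightarrow> 'n) cat" where
  "functor_category C D = \<lparr>
    Ob = {F. is_functor C D F \<and> fob F \<in> extensional (Ob C) \<and>
      (\<forall>X Y. fmor F X Y \<in> extensional (if X \<in> Ob C \<and> Y \<in> Ob C then Hom C X Y else {}))},
    Hom = (\<lambda>F G. {t \<in> extensional (Ob C). natural_transformation C D F G t}),
    Ident = (\<lambda>F. \<lambda>X \<in> Ob C. Ident D (fob F X)),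
    Comp = (\<lambda>F G H t s. \<lambda>X \<in> Ob C. Comp D (fob F X) (fob G X) (fob H X) (t X) (s X))\<rparr>"

text \<open>
  The category of sets relative to a universe: its objects are all subsets of the type \<open>'u\<close>.
\<close>

definition set_category :: "('u set, 'u \<Rightarrow> 'u) cat" where
  "set_category = \<lparr>Ob = UNIV, Hom = (\<lambda>A B. A \<rightarrow>\<^sub>E B), Ident = (\<lambda>A. \<lambda>x \<in> A. x),
    Comp = (\<lambda>A B C g f. compose A g f)\<rparr>"


section \<open>Symmetric sets and Chermak partial groups\<close>

text \<open>
  The number \<open>n\<close> stands for the object \<open>[n] = {0, \<dots>, n}\<close>; a morphism \<open>[m] \<rightarrow> [n]\<close> is
  an arbitrary function \<open>{..m} \<rightarrow> {..n}\<close>.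
\<close>

definition upsilon :: "(nat, nat \<Rightarrow> nat) cat" where
  "upsilon = \<lparr>Ob = UNIV, Hom = (\<lambda>m n. {..m} \<rightarrow>\<^sub>E {..n}), Ident = (\<lambda>n. \<lambda>i \<in> {..n}. i),
    Comp = (\<lambda>l m n g f. compose {..l} g f)\<rparr>"

text \<open>
  For a symmetric set \<open>X\<close>, \<^term>\<open>fob X n\<close> is the set of \<open>n\<close>-simplices, and a function
  \<open>\<alpha> : [m] \<rightarrow> [n]\<close> acts by \<^term>\<open>fmor X n m \<alpha>\<close> from \<open>n\<close>-simplices to \<open>m\<close>-simplices.
\<close>

type_synonym 'u symset = "(nat, nat \<Rightarrow> nat, 'u set, 'u \<Rightarrow> 'u) cfunctor"

definition symmetric_sets :: "('u symset, nat \<Rightarrow> 'u \<Rightarrow> 'u) cat" where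
  "symmetric_sets = functor_category (opposite upsilon) set_category"

text \<open>
  An \<open>n\<close>-tuple in \<open>X\<^sub>1\<close> is represented as an extensional function on \<open>{1..n}\<close>.
\<close>

definition segal_map :: "'u symset \<Rightarrow> nat \<Rightarrow> 'u \<Rightarrow> nat \<Rightarrow> 'u" where
  "segal_map X n x = (\<lambda>i \<in> {1..n}. fmor X n 1 (\<lambda>k \<in> {..1}. if k = 0 then i - 1 else i) x)"

definition spiny :: "'u symset \<Rightarrow> bool" where
  "spiny X \<longleftrightarrow> (\<forall>n \<ge> 2. inj_on (segal_map X n) (fob X n))"

definition reduced :: "'u symset \<Rightarrow> bool" where
  "reduced X \<longleftrightarrow> (\<exists>x. fob X 0 = {x})"

definition partial_groups :: "('u symset, nat \<Rightarrow> 'u \<Rightarrow> 'u) cat" where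
  "partial_groups = full_subcategory symmetric_sets (\<lambda>X. reduced X \<and> spiny X)"

definition symmetric_subset :: "'u symset \<Rightarrow> (nat \<Rightarrow> 'u set) \<Rightarrow> bool" where
  "symmetric_subset X S \<longleftrightarrow> (\<forall>n. S n \<subseteq> fob X n) \<and>
    (\<forall>m n. \<forall>\<alpha> \<in> Hom upsilon m n. fmor X n m \<alpha> ` S n \<subseteq> S m)"

definition skeleton2 :: "'u symset \<Rightarrow> nat \<Rightarrow> 'u set" where
  "skeleton2 X n = \<Inter> {S n | S. symmetric_subset X S \<and> (\<forall>k \<le> 2. fob X k \<subseteq> S k)}"

definition two_skeletal :: "'u symset \<Rightarrow> bool" where
  "two_skeletal X \<longleftrightarrow> (\<forall>n. skeleton2 X n = fob X n)"

definition two_skeletal_partial_groups :: "('u symset, nat \<Rightarrow> 'u \<Rightarrow> 'u) cat" where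
  "two_skeletal_partial_groups = full_subcategory partial_groups two_skeletal"


section \<open>Binary partial groups\<close>

text \<open>
  The value \<^term>\<open>None\<close> means that a product is undefined, so that the relation
  ``both undefined, or both defined and equal'' is equality of options.
\<close>

record 'u partial_magma =
  pcarrier :: "'u set"
  pmult :: "'u \<Rightarrow> 'u \<Rightarrow> 'u option"
  pone :: "'u"

locale unital_partial_magma =
  fixes P :: "'u partial_magma"
  assumes mult_closed: "pmult P a b = Some c \<Longrightarrow> a \<in> pcarrier P \<and> b \<in> pcarrier P \<and> c \<in> pcarrier P"
    and one_closed: "pone P \<in> pcarrier P"
    and mult_one: "a \<in> pcarrier P \<Longrightarrow> pmult P a (pone P) = Some a"
    and one_mult: "a \<in> pcarrier P \<Longrightarrow> pmult P (pone P) a = Some a"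

locale binary_partial_group = unital_partial_magma +
  assumes ex_inverse: "a \<in> pcarrier P \<Longrightarrow> \<exists>a' \<in> pcarrier P. \<forall>b \<in> pcarrier P.
    (\<forall>c. pmult P a b = Some c \<longrightarrow> pmult P a' c = Some b) \<and>
    (\<forall>c. pmult P b a = Some c \<longrightarrow> pmult P c a' = Some b)"

definition bpg_hom :: "'u partial_magma \<Rightarrow> 'u partial_magma \<Rightarrow> ('u \<Rightarrow> 'u) set" where
  "bpg_hom P Q = {f \<in> pcarrier P \<rightarrow>\<^sub>E pcarrier Q. \<forall>a \<in> pcarrier P. \<forall>b \<in> pcarrier P. \<forall>c.
    pmult P a b = Some c \<longrightarrow> pmult Q (f a) (f b) = Some (f c)}"

definition binary_partial_groups :: "('u partial_magma, 'u \<Rightarrow> 'u) cat" where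
  "binary_partial_groups = \<lparr>Ob = {P. binary_partial_group P}, Hom = bpg_hom,
    Ident = (\<lambda>P. \<lambda>x \<in> pcarrier P. x), Comp = (\<lambda>P Q R g f. compose (pcarrier P) g f)\<rparr>"

end

theory Submission
  imports Defs
begin

text \<open>
  The equivalence sends a partial group \<open>X\<close> to its set \<open>X\<^sub>1\<close> of edges, where \<open>a b = c\<close> means
  that some 2-simplex has consecutive edges \<open>a\<close>, \<open>b\<close> and long edge \<open>c\<close>; a map \<open>t\<close> is sent to
  \<open>t\<^sub>1\<close>. This functor is shown to be fully faithful and essentially surjective.

  Everything is controlled by the matrix of edges \<open>m i j\<close> of an \<open>n\<close>-simplex
  (\<open>i, j \<le> n\<close>). It is coherent: \<open>m i i = 1\<close>, and all products \<open>m i j \<cdot> m j k = m i k\<close> are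
  defined. A coherent matrix over a binary partial group is determined by its spine
  \<open>m 0 1, m 1 2, \<dots>\<close> (\<open>coherent_eqI\<close>); every defined product \<open>a b = c\<close> is the spine of a
  coherent matrix of size 3 (\<open>ex_coherent_triangle\<close>); and homomorphisms preserve coherence
  (\<open>coherent_hom\<close>).

  The functor is faithful because a simplex of a spiny symmetric set is determined by its spine.
  It is full because in a 2-skeletal \<open>X\<close> each simplex is \<open>\<alpha>\<^sup>* z\<close> for a 2-simplex \<open>z\<close>
  (\<open>two_skeletal_iff\<close>): a homomorphism \<open>f\<close> maps the product recorded by \<open>z\<close> to the product
  recorded by a 2-simplex \<open>w\<close> of the target, \<open>z\<close> and \<open>w\<close> have corresponding edge matrices, and
  so \<open>\<alpha>\<^sup>* w\<close> is the image of \<open>\<alpha>\<^sup>* z\<close>. Naturality follows since the image is determined by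
  its edges. For essential surjectivity, the \<open>n\<close>-simplices of the symmetric set belonging to a
  binary partial group \<open>P\<close> are the coherent matrices on \<open>[n]\<close> that are pulled back from a
  coherent matrix on \<open>[2]\<close>. As simplices must be elements of the type \<open>'u\<close>, these matrices
  are encoded by injections into \<open>'u\<close>, which exist because \<open>'u\<close> is infinite.
\<close>

section \<open>Equivalences of categories\<close>

lemma is_functor_id: "category C \<Longrightarrow> is_functor C C id_functor"
  by (simp add: is_functor_def is_functor_axioms_def id_functor_def)

lemma is_functor_comp:
  assumes "is_functor C D F" "is_functor D E G"
  shows "is_functor C E (comp_functor G F)"
proof -
  interpret F: is_functor C D F by fact
  interpret G: is_functor D E G by fact
  show ?thesis
    by unfold_locales
      (simp_all add: comp_functor_def F.fob_ob G.fob_ob F.fmor_hom G.fmor_hom F.fmor_ident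
        G.fmor_ident F.fmor_comp G.fmor_comp)
qed

text \<open>
  The quasi-inverse \<open>G\<close> chooses for every object \<open>Z\<close> a preimage \<open>K Z\<close> up to an isomorphism
  \<open>e Z : F (K Z) \<rightarrow> Z\<close>, and acts on morphisms by lifting along \<open>F\<close> their conjugates by \<open>e\<close>.
\<close>

lemma equivalent_categories_if_fully_faithful_ess_surj:
  assumes "is_functor C D F"
    and full: "\<And>X Y g. \<lbrakk>X \<in> Ob C; Y \<in> Ob C; g \<in> Hom D (fob F X) (fob F Y)\<rbrakk>
      \<Longrightarrow> \<exists>f \<in> Hom C X Y. fmor F X Y f = g"
    and faithful: "\<And>X Y f g. \<lbrakk>X \<in> Ob C; Y \<in> Ob C; f \<in> Hom C X Y; g \<in> Hom C X Y;
      fmor F X Y f = fmor F X Y g\<rbrakk> \<Longrightarrow> f = g"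
    and ess_surj: "\<And>Z. Z \<in> Ob D \<Longrightarrow> \<exists>X \<in> Ob C. \<exists>h. isomorphism D (fob F X) Z h"
  shows "equivalent_categories C D"
proof -
  interpret F: is_functor C D F by fact
  \<comment> \<open>The inverse of \<open>F\<close> on hom-sets, which is defined as \<open>F\<close> is full.\<close>
  define lift where "lift X Y = inv_into (Hom C X Y) (fmor F X Y)" for X Y
  have lift_hom: "lift X Y g \<in> Hom C X Y" and F_lift: "fmor F X Y (lift X Y g) = g"
    if "X \<in> Ob C" "Y \<in> Ob C" "g \<in> Hom D (fob F X) (fob F Y)" for X Y g
  proof -
    from full[OF that] have "g \<in> fmor F X Y ` Hom C X Y" by blast
    then show "lift X Y g \<in> Hom C X Y" "fmor F X Y (lift X Y g) = g"
      unfolding lift_def by (rule inv_into_into, rule f_inv_into_f)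
  qed
  obtain K e where K: "\<And>Z. Z \<in> Ob D \<Longrightarrow> K Z \<in> Ob C"
    and iso: "\<And>Z. Z \<in> Ob D \<Longrightarrow> isomorphism D (fob F (K Z)) Z (e Z)"
    using ess_surj by metis
  obtain e' where e': "\<And>Z. Z \<in> Ob D \<Longrightarrow> e' Z \<in> Hom D Z (fob F (K Z))"
    and inv1: "\<And>Z. Z \<in> Ob D \<Longrightarrow>
      Comp D (fob F (K Z)) Z (fob F (K Z)) (e' Z) (e Z) = Ident D (fob F (K Z))"
    and inv2: "\<And>Z. Z \<in> Ob D \<Longrightarrow> Comp D Z (fob F (K Z)) Z (e Z) (e' Z) = Ident D Z"
    using iso unfolding isomorphism_def by metis
  have e: "\<And>Z. Z \<in> Ob D \<Longrightarrow> e Z \<in> Hom D (fob F (K Z)) Z"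
    using iso unfolding isomorphism_def by blast
  have FK: "\<And>Z. Z \<in> Ob D \<Longrightarrow> fob F (K Z) \<in> Ob D"
    using K F.fob_ob by blast
  have eq_if_F_eq: "f = g"
    if "fmor F X Y f = fmor F X Y g" "f \<in> Hom C X Y" "g \<in> Hom C X Y" "X \<in> Ob C" "Y \<in> Ob C"
    for X Y f g
    using faithful that by blast
  define conj where "conj Z W g =
    Comp D (fob F (K Z)) W (fob F (K W)) (e' W) (Comp D (fob F (K Z)) Z W g (e Z))" for Z W g
  have conj_hom: "conj Z W g \<in> Hom D (fob F (K Z)) (fob F (K W))"
    if "Z \<in> Ob D" "W \<in> Ob D" "g \<in> Hom D Z W" for Z W g
    unfolding conj_def using that by (meson F.D.comp_hom FK e e')
  have e_conj: "Comp D (fob F (K Z)) (fob F (K W)) W (e W) (conj Z W g) =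
      Comp D (fob F (K Z)) Z W g (e Z)"
    if "Z \<in> Ob D" "W \<in> Ob D" "g \<in> Hom D Z W" for Z W g
  proof -
    have "Comp D (fob F (K Z)) Z W g (e Z) \<in> Hom D (fob F (K Z)) W"
      using that by (meson F.D.comp_hom FK e)
    then show ?thesis
      unfolding conj_def using that
      by (simp add: F.D.comp_assoc[where W = "fob F (K Z)" and X = W and Y = "fob F (K W)" and Z = W]
          FK e e' inv2 F.D.ident_left)
  qed
  have conj_e': "Comp D Z (fob F (K Z)) (fob F (K W)) (conj Z W g) (e' Z) =
      Comp D Z W (fob F (K W)) (e' W) g"
    if "Z \<in> Ob D" "W \<in> Ob D" "g \<in> Hom D Z W" for Z W g
  proof -
    have ge: "Comp D (fob F (K Z)) Z W g (e Z) \<in> Hom D (fob F (K Z)) W"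
      using that by (meson F.D.comp_hom FK e)
    have "Comp D Z (fob F (K Z)) W (Comp D (fob F (K Z)) Z W g (e Z)) (e' Z) = g"
      using that F.D.comp_assoc[of Z "fob F (K Z)" Z W "e' Z" "e Z" g]
      by (simp add: FK e e' inv2 F.D.ident_right)
    then show ?thesis
      unfolding conj_def using that ge
        F.D.comp_assoc[of Z "fob F (K Z)" W "fob F (K W)" "e' Z"
          "Comp D (fob F (K Z)) Z W g (e Z)" "e' W"]
      by (simp add: FK e')
  qed
  have conj_comp: "conj Z V (Comp D Z W V h g) =
      Comp D (fob F (K Z)) (fob F (K W)) (fob F (K V)) (conj W V h) (conj Z W g)"
    if o: "Z \<in> Ob D" "W \<in> Ob D" "V \<in> Ob D" and g: "g \<in> Hom D Z W" and h: "h \<in> Hom D W V"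
    for Z W V g h
  proof -
    let ?K = "\<lambda>Z. fob F (K Z)"
    have ge: "Comp D (?K Z) Z W g (e Z) \<in> Hom D (?K Z) W"
      using o g by (meson F.D.comp_hom FK e)
    have "Comp D (?K Z) (?K W) (?K V) (conj W V h) (conj Z W g) =
        Comp D (?K Z) W (?K V) (Comp D W (?K W) (?K V) (conj W V h) (e' W))
          (Comp D (?K Z) Z W g (e Z))"
      unfolding conj_def[of Z W] using F.D.comp_assoc[OF FK _ FK FK ge e' conj_hom] o g h
      by simp
    also have "\<dots> = Comp D (?K Z) W (?K V) (Comp D W V (?K V) (e' V) h)
          (Comp D (?K Z) Z W g (e Z))"
      using conj_e' o h by simp
    also have "\<dots> = Comp D (?K Z) V (?K V) (e' V)
          (Comp D (?K Z) W V h (Comp D (?K Z) Z W g (e Z)))"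
      using F.D.comp_assoc[OF FK _ _ FK ge h e'] o by simp
    also have "\<dots> = conj Z V (Comp D Z W V h g)"
      unfolding conj_def using F.D.comp_assoc[OF FK _ _ _ e g h] o by simp
    finally show ?thesis ..
  qed
  define G where "G = \<lparr>fob = K, fmor = (\<lambda>Z W g. lift (K Z) (K W) (conj Z W g))\<rparr>"
  have FG: "fmor F (K Z) (K W) (fmor G Z W g) = conj Z W g"
    and G_hom: "fmor G Z W g \<in> Hom C (K Z) (K W)"
    if "Z \<in> Ob D" "W \<in> Ob D" "g \<in> Hom D Z W" for Z W g
    using that by (simp_all add: G_def F_lift lift_hom K conj_hom)
  have fob_G: "fob G Z = K Z" for Z
    by (simp add: G_def)
  have G: "is_functor D C G"
  proof unfold_locales
    show "fob G Z \<in> Ob C" if "Z \<in> Ob D" for Z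
      using that by (simp add: fob_G K)
    show "fmor G Z W g \<in> Hom C (fob G Z) (fob G W)"
      if "Z \<in> Ob D" "W \<in> Ob D" "g \<in> Hom D Z W" for Z W g
      using that by (simp add: fob_G G_hom)
    show "fmor G Z Z (Ident D Z) = Ident C (fob G Z)" if "Z \<in> Ob D" for Z
      unfolding fob_G
    proof (rule eq_if_F_eq[where X = "K Z" and Y = "K Z"])
      show "fmor F (K Z) (K Z) (fmor G Z Z (Ident D Z)) = fmor F (K Z) (K Z) (Ident C (K Z))"
        using that
        by (simp add: FG F.D.ident_hom F.fmor_ident K conj_def F.D.ident_left FK e inv1)
    qed (use that in \<open>simp_all add: G_hom F.D.ident_hom F.C.ident_hom K\<close>)
    show "fmor G Z V (Comp D Z W V h g) =
        Comp C (fob G Z) (fob G W) (fob G V) (fmor G W V h) (fmor G Z W g)"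
      if "Z \<in> Ob D" "W \<in> Ob D" "V \<in> Ob D" "g \<in> Hom D Z W" "h \<in> Hom D W V" for Z W V g h
      unfolding fob_G
    proof (rule eq_if_F_eq[where X = "K Z" and Y = "K V"])
      show "fmor F (K Z) (K V) (fmor G Z V (Comp D Z W V h g)) =
          fmor F (K Z) (K V) (Comp C (K Z) (K W) (K V) (fmor G W V h) (fmor G Z W g))"
        using that
        by (simp add: FG F.D.comp_hom[of Z W V] F.fmor_comp[of "K Z" "K W" "K V"] K G_hom conj_comp)
    next
      show "Comp C (K Z) (K W) (K V) (fmor G W V h) (fmor G Z W g) \<in> Hom C (K Z) (K V)"
        using that by (meson F.C.comp_hom G_hom K)
    next
      show "fmor G Z V (Comp D Z W V h g) \<in> Hom C (K Z) (K V)"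
        using that by (meson F.D.comp_hom G_hom)
    qed (use that in \<open>simp_all add: K\<close>)
  qed
  define \<eta> where "\<eta> X = lift X (K (fob F X)) (e' (fob F X))" for X
  have \<eta>_hom: "\<eta> X \<in> Hom C X (K (fob F X))"
    and F_\<eta>: "fmor F X (K (fob F X)) (\<eta> X) = e' (fob F X)" if "X \<in> Ob C" for X
    using that by (simp_all add: \<eta>_def lift_hom F_lift K F.fob_ob e')
  have \<eta>_iso: "isomorphism C X (K (fob F X)) (\<eta> X)" if X: "X \<in> Ob C" for X
  proof -
    let ?Z = "fob F X"
    have Z: "?Z \<in> Ob D" "K ?Z \<in> Ob C"
      using X by (simp_all add: F.fob_ob K)
    \<comment> \<open>The inverse of \<open>\<eta> X\<close>, lifted from that of \<open>F (\<eta> X)\<close>.\<close>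
    define \<theta> where "\<theta> = lift (K ?Z) X (e ?Z)"
    have \<theta>: "\<theta> \<in> Hom C (K ?Z) X" "fmor F (K ?Z) X \<theta> = e ?Z"
      using X Z by (simp_all add: \<theta>_def lift_hom F_lift e)
    have "Comp C X (K ?Z) X \<theta> (\<eta> X) = Ident C X"
      by (rule eq_if_F_eq[where X = X and Y = X])
        (use X Z \<theta> \<eta>_hom[OF X] F.C.comp_hom[OF X Z(2) X] in
          \<open>simp_all add: F.fmor_comp[of X "K ?Z" X] F_\<eta> inv2 F.fmor_ident F.C.ident_hom\<close>)
    moreover have "Comp C (K ?Z) X (K ?Z) (\<eta> X) \<theta> = Ident C (K ?Z)"
      by (rule eq_if_F_eq[where X = "K ?Z" and Y = "K ?Z"])
        (use X Z \<theta> \<eta>_hom[OF X] F.C.comp_hom[OF Z(2) X Z(2)] in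
          \<open>simp_all add: F.fmor_comp[of "K ?Z" X "K ?Z"] F_\<eta> inv1 F.fmor_ident F.C.ident_hom\<close>)
    ultimately show ?thesis
      unfolding isomorphism_def using \<theta> \<eta>_hom[OF X] by blast
  qed
  have "natural_transformation C C id_functor (comp_functor G F) \<eta>"
  proof -
    have "Comp C X Y (K (fob F Y)) (\<eta> Y) f =
        Comp C X (K (fob F X)) (K (fob F Y)) (fmor G (fob F X) (fob F Y) (fmor F X Y f)) (\<eta> X)"
      if X: "X \<in> Ob C" and Y: "Y \<in> Ob C" and f: "f \<in> Hom C X Y" for X Y f
    proof (rule eq_if_F_eq[where X = X and Y = "K (fob F Y)"])
      let ?f = "fmor F X Y f"
      have Ff: "?f \<in> Hom D (fob F X) (fob F Y)" "fob F X \<in> Ob D" "fob F Y \<in> Ob D"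
        using X Y f by (simp_all add: F.fmor_hom F.fob_ob)
      note GFf = G_hom[OF Ff(2,3,1)]
      show "fmor F X (K (fob F Y)) (Comp C X Y (K (fob F Y)) (\<eta> Y) f) =
          fmor F X (K (fob F Y))
            (Comp C X (K (fob F X)) (K (fob F Y)) (fmor G (fob F X) (fob F Y) ?f) (\<eta> X))"
        using X Y f Ff GFf
        by (simp add: F.fmor_comp[of X Y "K (fob F Y)"]
            F.fmor_comp[of X "K (fob F X)" "K (fob F Y)"] \<eta>_hom F_\<eta> K FG conj_e')
      show "Comp C X Y (K (fob F Y)) (\<eta> Y) f \<in> Hom C X (K (fob F Y))"
        using X Y f Ff by (meson F.C.comp_hom K \<eta>_hom)
      show "Comp C X (K (fob F X)) (K (fob F Y)) (fmor G (fob F X) (fob F Y) ?f) (\<eta> X)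
          \<in> Hom C X (K (fob F Y))"
        using X Y Ff GFf by (meson F.C.comp_hom K \<eta>_hom)
    qed (use X Y in \<open>simp_all add: F.fob_ob K\<close>)
    then show ?thesis
      unfolding natural_transformation_def
      using is_functor_id[OF F.C.category_axioms] is_functor_comp[OF assms(1) G] \<eta>_hom
      by (simp add: id_functor_def comp_functor_def fob_G)
  qed
  then have "natural_isomorphism C C id_functor (comp_functor G F) \<eta>"
    unfolding natural_isomorphism_def using \<eta>_iso
    by (simp add: id_functor_def comp_functor_def fob_G)
  moreover have "natural_isomorphism D D (comp_functor F G) id_functor e"
    unfolding natural_isomorphism_def natural_transformation_def
    using is_functor_id[OF F.D.category_axioms] is_functor_comp[OF G assms(1)] e iso
    by (simp add: id_functor_def comp_functor_def fob_G FG e_conj)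
  ultimately show ?thesis
    unfolding equivalent_categories_def using assms(1) G by blast
qed

section \<open>The categories of symmetric sets and of binary partial groups\<close>

lemma category_opposite: "category C \<Longrightarrow> category (opposite C)"
  by (auto simp: category_def opposite_def)

lemma category_full_subcategory: "category C \<Longrightarrow> category (full_subcategory C p)"
  by (simp add: category_def full_subcategory_def)

lemma category_set_category: "category set_category"
proof
  fix W X Y Z :: "'u set" and f g h
  assume "f \<in> Hom set_category W X" "g \<in> Hom set_category X Y" "h \<in> Hom set_category Y Z"
  then show "Comp set_category W Y Z h (Comp set_category W X Y g f) =
      Comp set_category W X Z (Comp set_category X Y Z h g) f"
    by (auto simp: set_category_def fun_eq_iff compose_def)
qed (auto simp: set_category_def fun_eq_iff compose_def PiE_def extensional_def)

lemma category_upsilon: "category upsilon"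
proof
  fix W X Y Z :: nat and f g h
  assume "f \<in> Hom upsilon W X" "g \<in> Hom upsilon X Y" "h \<in> Hom upsilon Y Z"
  then show "Comp upsilon W Y Z h (Comp upsilon W X Y g f) =
      Comp upsilon W X Z (Comp upsilon X Y Z h g) f"
    by (auto simp: upsilon_def fun_eq_iff compose_def)
qed (auto simp: upsilon_def fun_eq_iff compose_def PiE_def extensional_def Pi_iff)

lemma category_functor_category:
  assumes "category C" "category D"
  shows "category (functor_category C D)"
proof -
  interpret C: category C by fact
  interpret D: category D by fact
  note defs = functor_category_def natural_transformation_def
  show ?thesis
  proof
    fix F assume "F \<in> Ob (functor_category C D)"
    then have "is_functor C D F" by (simp add: functor_category_def)
    then interpret F: is_functor C D F .
    show "Ident (functor_category C D) F \<in> Hom (functor_category C D) F F"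
      by (auto simp: defs F.is_functor_axioms D.ident_hom F.fob_ob D.ident_left D.ident_right
          F.fmor_hom)
  next
    fix F G H s t
    assume "F \<in> Ob (functor_category C D)" "G \<in> Ob (functor_category C D)"
      "H \<in> Ob (functor_category C D)"
    then have FGH: "is_functor C D F" "is_functor C D G" "is_functor C D H"
      by (simp_all add: functor_category_def)
    interpret F: is_functor C D F by fact
    interpret G: is_functor C D G by fact
    interpret H: is_functor C D H by fact
    assume s: "s \<in> Hom (functor_category C D) F G" and t: "t \<in> Hom (functor_category C D) G H"
    have sh: "\<And>X. X \<in> Ob C \<Longrightarrow> s X \<in> Hom D (fob F X) (fob G X)"
      and th: "\<And>X. X \<in> Ob C \<Longrightarrow> t X \<in> Hom D (fob G X) (fob H X)"
      and sn: "\<And>X Y f. \<lbrakk>X \<in> Ob C; Y \<in> Ob C; f \<in> Hom C X Y\<rbrakk> \<Longrightarrow>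
        Comp D (fob F X) (fob F Y) (fob G Y) (s Y) (fmor F X Y f) =
        Comp D (fob F X) (fob G X) (fob G Y) (fmor G X Y f) (s X)"
      and tn: "\<And>X Y f. \<lbrakk>X \<in> Ob C; Y \<in> Ob C; f \<in> Hom C X Y\<rbrakk> \<Longrightarrow>
        Comp D (fob G X) (fob G Y) (fob H Y) (t Y) (fmor G X Y f) =
        Comp D (fob G X) (fob H X) (fob H Y) (fmor H X Y f) (t X)"
      using s t by (simp_all add: defs)
    have "Comp D (fob F X) (fob F Y) (fob H Y)
        (Comp D (fob F Y) (fob G Y) (fob H Y) (t Y) (s Y)) (fmor F X Y f) =
      Comp D (fob F X) (fob H X) (fob H Y) (fmor H X Y f)
        (Comp D (fob F X) (fob G X) (fob H X) (t X) (s X))"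
      if X: "X \<in> Ob C" and Y: "Y \<in> Ob C" and f: "f \<in> Hom C X Y" for X Y f
    proof -
      note o = F.fob_ob[OF X] G.fob_ob[OF X] H.fob_ob[OF X]
        F.fob_ob[OF Y] G.fob_ob[OF Y] H.fob_ob[OF Y]
      note h = sh[OF X] sh[OF Y] th[OF X] th[OF Y] F.fmor_hom[OF X Y f] G.fmor_hom[OF X Y f]
        H.fmor_hom[OF X Y f]
      show ?thesis
        using D.comp_assoc[OF o(1,4,5,6) h(5,2,4)] D.comp_assoc[OF o(1,2,5,6) h(1,6,4)]
          D.comp_assoc[OF o(1,2,3,6) h(1,3,7)] sn[OF X Y f] tn[OF X Y f]
        by simp
    qed
    moreover have "Comp D (fob F X) (fob G X) (fob H X) (t X) (s X) \<in> Hom D (fob F X) (fob H X)"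
      if X: "X \<in> Ob C" for X
      using D.comp_hom[OF F.fob_ob[OF X] G.fob_ob[OF X] H.fob_ob[OF X] sh[OF X] th[OF X]] .
    ultimately show "Comp (functor_category C D) F G H t s \<in> Hom (functor_category C D) F H"
      by (simp add: defs FGH)
  next
    fix F G s
    assume "F \<in> Ob (functor_category C D)" "G \<in> Ob (functor_category C D)"
    then have FG: "is_functor C D F" "is_functor C D G"
      by (simp_all add: functor_category_def)
    interpret F: is_functor C D F by fact
    interpret G: is_functor C D G by fact
    assume s: "s \<in> Hom (functor_category C D) F G"
    then show "Comp (functor_category C D) F G G (Ident (functor_category C D) G) s = s"
      "Comp (functor_category C D) F F G s (Ident (functor_category C D) F) = s"
      by (auto simp: defs fun_eq_iff D.ident_left D.ident_right F.fob_ob G.fob_ob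
          extensional_def restrict_def)
  next
    fix F G H K s t u
    assume "F \<in> Ob (functor_category C D)" "G \<in> Ob (functor_category C D)"
      "H \<in> Ob (functor_category C D)" "K \<in> Ob (functor_category C D)"
    then have "is_functor C D F" "is_functor C D G" "is_functor C D H" "is_functor C D K"
      by (simp_all add: functor_category_def)
    then have o: "fob F X \<in> Ob D" "fob G X \<in> Ob D" "fob H X \<in> Ob D" "fob K X \<in> Ob D"
      if "X \<in> Ob C" for X
      using that by (simp_all add: is_functor.fob_ob)
    assume "s \<in> Hom (functor_category C D) F G" "t \<in> Hom (functor_category C D) G H"
      "u \<in> Hom (functor_category C D) H K"
    then show "Comp (functor_category C D) F H K u (Comp (functor_category C D) F G H t s) =
        Comp (functor_category C D) F G K (Comp (functor_category C D) G H K u t) s"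
      by (auto simp: defs fun_eq_iff restrict_def intro!: D.comp_assoc o)
  qed
qed

lemma category_two_skeletal_partial_groups: "category two_skeletal_partial_groups"
  unfolding two_skeletal_partial_groups_def partial_groups_def symmetric_sets_def
  by (intro category_full_subcategory category_functor_category category_opposite
      category_upsilon category_set_category)

lemma category_binary_partial_groups: "category binary_partial_groups"
proof
  fix P Q :: "'u partial_magma" and f
  assume "f \<in> Hom binary_partial_groups P Q"
  then show "Comp binary_partial_groups P Q Q (Ident binary_partial_groups Q) f = f"
    "Comp binary_partial_groups P P Q f (Ident binary_partial_groups P) = f"
    by (auto simp: binary_partial_groups_def bpg_hom_def compose_def fun_eq_iff PiE_def
        extensional_def Pi_iff)
next
  fix P :: "'u partial_magma"
  assume "P \<in> Ob binary_partial_groups"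
  then interpret binary_partial_group P by (simp add: binary_partial_groups_def)
  show "Ident binary_partial_groups P \<in> Hom binary_partial_groups P P"
    by (auto simp: binary_partial_groups_def bpg_hom_def dest: mult_closed)
next
  fix P Q R :: "'u partial_magma" and f g
  assume "P \<in> Ob binary_partial_groups"
  then interpret binary_partial_group P by (simp add: binary_partial_groups_def)
  assume "f \<in> Hom binary_partial_groups P Q" "g \<in> Hom binary_partial_groups Q R"
  then show "Comp binary_partial_groups P Q R g f \<in> Hom binary_partial_groups P R"
    by (auto simp: binary_partial_groups_def bpg_hom_def compose_def dest: mult_closed)
      (metis PiE_mem)
next
  fix P Q R S :: "'u partial_magma" and f g h
  assume "f \<in> Hom binary_partial_groups P Q" "g \<in> Hom binary_partial_groups Q R"
    "h \<in> Hom binary_partial_groups R S"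
  then show "Comp binary_partial_groups P R S h (Comp binary_partial_groups P Q R g f) =
      Comp binary_partial_groups P Q S (Comp binary_partial_groups Q R S h g) f"
    by (auto simp: binary_partial_groups_def bpg_hom_def compose_def fun_eq_iff)
qed

section \<open>Edges of simplices\<close>

text \<open>
  The objects of \<^const>\<open>symmetric_sets\<close> with the functor laws spelled out; the last two conditions
  say that maps of sets and the components of a functor take the default value outside of their
  domains.
\<close>

locale symmetric_set =
  fixes X :: "'u symset"
  assumes act_closed: "\<lbrakk>\<alpha> \<in> {..m} \<rightarrow>\<^sub>E {..n}; x \<in> fob X n\<rbrakk> \<Longrightarrow> fmor X n m \<alpha> x \<in> fob X m"
    and act_id: "x \<in> fob X n \<Longrightarrow> fmor X n n (\<lambda>i \<in> {..n}. i) x = x"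
    and act_act: "\<lbrakk>\<alpha> \<in> {..m} \<rightarrow>\<^sub>E {..n}; \<beta> \<in> {..l} \<rightarrow>\<^sub>E {..m}; x \<in> fob X n\<rbrakk>
      \<Longrightarrow> fmor X m l \<beta> (fmor X n m \<alpha> x) = fmor X n l (compose {..l} \<alpha> \<beta>) x"
    and act_extensional: "\<alpha> \<in> {..m} \<rightarrow>\<^sub>E {..n} \<Longrightarrow> fmor X n m \<alpha> \<in> extensional (fob X n)"
    and fmor_extensional: "fmor X n m \<in> extensional ({..m} \<rightarrow>\<^sub>E {..n})"

lemma Ob_symmetric_sets: "X \<in> Ob symmetric_sets \<longleftrightarrow> symmetric_set X"
proof
  assume "X \<in> Ob symmetric_sets"
  then have "is_functor (opposite upsilon) set_category X"
    and ext: "\<And>n m. fmor X n m \<in> extensional ({..m} \<rightarrow>\<^sub>E {..n})"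
    by (auto simp: symmetric_sets_def functor_category_def opposite_def upsilon_def)
  then interpret X: is_functor "opposite upsilon" set_category X by simp
  note defs = opposite_def upsilon_def set_category_def
  have act: "fmor X n m \<alpha> \<in> fob X n \<rightarrow>\<^sub>E fob X m" if "\<alpha> \<in> {..m} \<rightarrow>\<^sub>E {..n}" for \<alpha> m n
    using X.fmor_hom[of n m \<alpha>] that by (simp add: defs)
  show "symmetric_set X"
  proof
    show "fmor X n m \<alpha> x \<in> fob X m" if "\<alpha> \<in> {..m} \<rightarrow>\<^sub>E {..n}" "x \<in> fob X n" for \<alpha> m n x
      using act that by blast
    show "fmor X n n (\<lambda>i \<in> {..n}. i) x = x" if "x \<in> fob X n" for n x
      using X.fmor_ident[of n] that by (simp add: defs)
    show "fmor X m l \<beta> (fmor X n m \<alpha> x) = fmor X n l (compose {..l} \<alpha> \<beta>) x"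
      if "\<alpha> \<in> {..m} \<rightarrow>\<^sub>E {..n}" "\<beta> \<in> {..l} \<rightarrow>\<^sub>E {..m}" "x \<in> fob X n" for \<alpha> \<beta> l m n x
      using X.fmor_comp[of n m l \<alpha> \<beta>] that by (simp add: defs compose_def)
    show "fmor X n m \<alpha> \<in> extensional (fob X n)" if "\<alpha> \<in> {..m} \<rightarrow>\<^sub>E {..n}" for \<alpha> m n
      using act[OF that] by (simp add: PiE_def)
    show "fmor X n m \<in> extensional ({..m} \<rightarrow>\<^sub>E {..n})" for n m
      by (rule ext)
  qed
next
  assume "symmetric_set X"
  then interpret symmetric_set X .
  interpret U: category "opposite upsilon"
    by (rule category_opposite[OF category_upsilon])
  interpret S: category set_category
    by (rule category_set_category)
  have act: "fmor X n m \<alpha> \<in> fob X n \<rightarrow>\<^sub>E fob X m" if "\<alpha> \<in> {..m} \<rightarrow>\<^sub>E {..n}" for \<alpha> m n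
    using act_closed[OF that] act_extensional[OF that] by (simp add: PiE_def)
  have "is_functor (opposite upsilon) set_category X"
  proof
    fix n :: nat
    have "(\<lambda>i \<in> {..n}. i) \<in> {..n} \<rightarrow>\<^sub>E {..n}"
      by auto
    then show "fmor X n n (Ident (opposite upsilon) n) = Ident set_category (fob X n)"
      using act_id act_extensional
      by (auto simp: opposite_def upsilon_def set_category_def fun_eq_iff extensional_def)
  next
    fix l m n and \<alpha> \<beta>
    assume a: "\<alpha> \<in> Hom (opposite upsilon) n m" "\<beta> \<in> Hom (opposite upsilon) m l"
    then have "compose {..l} \<alpha> \<beta> \<in> {..l} \<rightarrow>\<^sub>E {..n}"
      by (auto simp: opposite_def upsilon_def compose_def)
    then show "fmor X n l (Comp (opposite upsilon) n m l \<beta> \<alpha>) =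
        Comp set_category (fob X n) (fob X m) (fob X l) (fmor X m l \<beta>) (fmor X n m \<alpha>)"
      using a act_act act_extensional
      by (auto simp: opposite_def upsilon_def set_category_def fun_eq_iff compose_def
          extensional_def)
  qed (auto simp: opposite_def upsilon_def set_category_def intro!: act)
  then show "X \<in> Ob symmetric_sets"
    by (simp add: symmetric_sets_def functor_category_def opposite_def upsilon_def
        fmor_extensional)
qed

lemma Hom_symmetric_sets:
  assumes "symmetric_set X" "symmetric_set Y"
  shows "t \<in> Hom symmetric_sets X Y \<longleftrightarrow> (\<forall>n. t n \<in> fob X n \<rightarrow>\<^sub>E fob Y n) \<and>
    (\<forall>n m. \<forall>\<alpha> \<in> {..m} \<rightarrow>\<^sub>E {..n}. \<forall>x \<in> fob X n. t m (fmor X n m \<alpha> x) = fmor Y n m \<alpha> (t n x))"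
proof -
  have "is_functor (opposite upsilon) set_category X" "is_functor (opposite upsilon) set_category Y"
    using assms unfolding Ob_symmetric_sets[symmetric]
    by (simp_all add: symmetric_sets_def functor_category_def)
  then have "t \<in> Hom symmetric_sets X Y \<longleftrightarrow> (\<forall>n. t n \<in> fob X n \<rightarrow>\<^sub>E fob Y n) \<and>
      (\<forall>n m. \<forall>\<alpha> \<in> {..m} \<rightarrow>\<^sub>E {..n}.
        compose (fob X n) (t m) (fmor X n m \<alpha>) = compose (fob X n) (fmor Y n m \<alpha>) (t n))"
    by (simp add: symmetric_sets_def functor_category_def natural_transformation_def
        opposite_def upsilon_def set_category_def)
  then show ?thesis
    by (auto simp: compose_def fun_eq_iff restrict_def)
qed

text \<open>
  The map \<open>[1] \<rightarrow> [n]\<close> with values \<open>i\<close> and \<open>j\<close>; it does not depend on \<open>n\<close>.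
\<close>

definition edge_map :: "nat \<Rightarrow> nat \<Rightarrow> nat \<Rightarrow> nat" where
  "edge_map i j = (\<lambda>k \<in> {..1}. if k = 0 then i else j)"

text \<open>
  The edge from vertex \<open>i\<close> to vertex \<open>j\<close> of the \<open>n\<close>-simplex \<open>x\<close>.
\<close>

definition edge :: "'u symset \<Rightarrow> nat \<Rightarrow> 'u \<Rightarrow> nat \<Rightarrow> nat \<Rightarrow> 'u" where
  "edge X n x i j = fmor X n 1 (edge_map i j) x"

lemma edge_map_in: "\<lbrakk>i \<le> n; j \<le> n\<rbrakk> \<Longrightarrow> edge_map i j \<in> {..1} \<rightarrow>\<^sub>E {..n}"
  by (auto simp: edge_map_def)

lemma compose_edge_map: "compose {..1} \<alpha> (edge_map i j) = edge_map (\<alpha> i) (\<alpha> j)"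
  by (auto simp: compose_def edge_map_def)

lemma edge_map_0_1: "edge_map 0 1 = (\<lambda>k \<in> {..1}. k)"
  by (auto simp: edge_map_def fun_eq_iff)

context symmetric_set
begin

lemma edge_closed: "\<lbrakk>x \<in> fob X n; i \<le> n; j \<le> n\<rbrakk> \<Longrightarrow> edge X n x i j \<in> fob X 1"
  unfolding edge_def by (intro act_closed edge_map_in)

lemma edge_act:
  assumes "\<alpha> \<in> {..m} \<rightarrow>\<^sub>E {..n}" "x \<in> fob X n" "i \<le> m" "j \<le> m"
  shows "edge X m (fmor X n m \<alpha> x) i j = edge X n x (\<alpha> i) (\<alpha> j)"
  using assms act_act[OF assms(1) edge_map_in assms(2)] by (simp add: edge_def compose_edge_map del: One_nat_def)

lemma edge_0_1: "a \<in> fob X 1 \<Longrightarrow> edge X 1 a 0 1 = a"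
  by (simp only: edge_def edge_map_0_1 act_id)

end

lemma edge_Hom:
  assumes "symmetric_set X" "symmetric_set Y" "t \<in> Hom symmetric_sets X Y"
    and "x \<in> fob X n" "i \<le> n" "j \<le> n"
  shows "edge Y n (t n x) i j = t 1 (edge X n x i j)"
  using assms edge_map_in[of i n j] by (auto simp: Hom_symmetric_sets edge_def)

section \<open>The binary partial group of edges\<close>

text \<open>
  Chermak partial groups, that is, the objects of \<^const>\<open>partial_groups\<close>.
\<close>

locale partial_group = symmetric_set +
  assumes reduced: "reduced X" and spiny: "spiny X"

lemma Ob_two_skeletal: "X \<in> Ob two_skeletal_partial_groups \<longleftrightarrow> partial_group X \<and> two_skeletal X"
  by (auto simp: two_skeletal_partial_groups_def partial_groups_def full_subcategory_def
      Ob_symmetric_sets partial_group_def partial_group_axioms_def)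

lemma Hom_two_skeletal: "Hom two_skeletal_partial_groups = Hom symmetric_sets"
  by (simp add: two_skeletal_partial_groups_def partial_groups_def full_subcategory_def)

lemma Ident_two_skeletal:
  "Ident two_skeletal_partial_groups X = (\<lambda>n. \<lambda>x \<in> fob X n. x)"
  by (simp add: two_skeletal_partial_groups_def partial_groups_def full_subcategory_def
    symmetric_sets_def functor_category_def set_category_def opposite_def upsilon_def restrict_def)

lemma Comp_two_skeletal:
  "Comp two_skeletal_partial_groups X Y Z t s = (\<lambda>n. compose (fob X n) (t n) (s n))"
  by (simp add: two_skeletal_partial_groups_def partial_groups_def full_subcategory_def
    symmetric_sets_def functor_category_def set_category_def opposite_def upsilon_def restrict_def)

lemma segal_map_Suc: "i < n \<Longrightarrow> segal_map X n x (Suc i) = edge X n x i (Suc i)"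
  by (simp add: segal_map_def edge_def edge_map_def cong: if_cong)

lemma (in partial_group) simplex_eqI:
  assumes x: "x \<in> fob X n" and y: "y \<in> fob X n"
    and spine: "\<And>i. i < n \<Longrightarrow> edge X n x i (Suc i) = edge X n y i (Suc i)"
  shows "x = y"
proof -
  consider "n = 0" | "n = 1" | "n \<ge> 2" by linarith
  then show ?thesis
  proof cases
    case 1
    then show ?thesis using x y reduced by (auto simp: reduced_def)
  next
    case 2
    then show ?thesis
      using x y spine[of 0] edge_0_1[of x] edge_0_1[of y] by simp
  next
    case 3
    have "segal_map X n x i = segal_map X n y i" if "i \<in> {1..n}" for i
      using segal_map_Suc[of "i - 1" n X x] segal_map_Suc[of "i - 1" n X y] spine[of "i - 1"] that
      by (simp add: Suc_le_lessD)
    then have "segal_map X n x = segal_map X n y"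
      by (intro extensionalityI[of _ "{1..n}"]) (auto simp: segal_map_def)
    then show ?thesis
      using spiny 3 x y by (auto simp: spiny_def inj_on_def)
  qed
qed

text \<open>
  The set of edges with the partial product read off from the 2-simplices. In a spiny symmetric
  set the 2-simplex with given consecutive edges is unique, so that the description operator
  denotes it. The unit is the degenerate edge at the only vertex.
\<close>

definition edge_magma :: "'u symset \<Rightarrow> 'u partial_magma" where
  "edge_magma X = \<lparr>pcarrier = fob X 1,
    pmult = (\<lambda>a b. if \<exists>y \<in> fob X 2. edge X 2 y 0 1 = a \<and> edge X 2 y 1 2 = b
      then Some (edge X 2 (THE y. y \<in> fob X 2 \<and> edge X 2 y 0 1 = a \<and> edge X 2 y 1 2 = b) 0 2)
      else None),
    pone = fmor X 0 1 (edge_map 0 0) (the_elem (fob X 0))\<rparr>"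

text \<open>
  A matrix on the vertices of \<open>[n]\<close> that behaves like the edges of an \<open>n\<close>-simplex. Values
  outside of \<open>{..n}\<close> are irrelevant.
\<close>

definition coherent :: "'u partial_magma \<Rightarrow> nat \<Rightarrow> (nat \<Rightarrow> nat \<Rightarrow> 'u) \<Rightarrow> bool" where
  "coherent P n m \<longleftrightarrow> (\<forall>i\<le>n. m i i = pone P) \<and>
    (\<forall>i\<le>n. \<forall>j\<le>n. \<forall>k\<le>n. pmult P (m i j) (m j k) = Some (m i k))"

lemma coherent_pullback:
  "\<lbrakk>coherent P n m; \<alpha> \<in> {..l} \<rightarrow>\<^sub>E {..n}\<rbrakk> \<Longrightarrow> coherent P l (\<lambda>i j. m (\<alpha> i) (\<alpha> j))"
  by (fastforce simp: coherent_def PiE_def Pi_iff)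

lemma coherent_cong:
  "(\<And>i j. \<lbrakk>i \<le> n; j \<le> n\<rbrakk> \<Longrightarrow> m i j = m' i j) \<Longrightarrow> coherent P n m \<longleftrightarrow> coherent P n m'"
  by (simp add: coherent_def)

context partial_group
begin

lemma pcarrier_edge_magma: "pcarrier (edge_magma X) = fob X 1"
  by (simp add: edge_magma_def)

lemma pmult_edge_magma:
  "pmult (edge_magma X) a b = Some c \<longleftrightarrow>
    (\<exists>y \<in> fob X 2. edge X 2 y 0 1 = a \<and> edge X 2 y 1 2 = b \<and> edge X 2 y 0 2 = c)"
proof -
  have unique: "y = z"
    if "y \<in> fob X 2" "z \<in> fob X 2" "edge X 2 y 0 1 = edge X 2 z 0 1"
      "edge X 2 y 1 2 = edge X 2 z 1 2" for y z
  proof (rule simplex_eqI[OF that(1,2)])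
    fix i :: nat assume "i < 2"
    then have "i = 0 \<or> i = 1" by linarith
    then show "edge X 2 y i (Suc i) = edge X 2 z i (Suc i)"
      using that by (auto simp: numeral_2_eq_2)
  qed
  have "(THE y. y \<in> fob X 2 \<and> edge X 2 y 0 1 = a \<and> edge X 2 y 1 2 = b) = y"
    if "y \<in> fob X 2" "edge X 2 y 0 1 = a" "edge X 2 y 1 2 = b" for y
    using that unique by (intro the_equality) auto
  then show ?thesis
    by (auto simp: edge_magma_def)
qed

lemma coherent_edge:
  assumes x: "x \<in> fob X n"
  shows "coherent (edge_magma X) n (edge X n x)"
  unfolding coherent_def
proof (intro conjI allI impI)
  fix i assume i: "i \<le> n"
  \<comment> \<open>The constant map \<open>[1] \<rightarrow> [n]\<close> with value \<open>i\<close> factors through \<open>[0]\<close>.\<close>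
  define c where "c = (\<lambda>k \<in> {..0::nat}. i)"
  have c: "c \<in> {..0} \<rightarrow>\<^sub>E {..n}" using i by (auto simp: c_def)
  have "compose {..1} c (edge_map 0 0) = edge_map i i"
    unfolding compose_edge_map by (simp add: c_def)
  then have "edge X n x i i = fmor X 0 1 (edge_map 0 0) (fmor X n 0 c x)"
    unfolding edge_def using act_act[OF c edge_map_in[of 0 0 0] x] by simp
  moreover have "fmor X n 0 c x = the_elem (fob X 0)"
    using act_closed[OF c x] reduced by (auto simp: reduced_def)
  ultimately show "edge X n x i i = pone (edge_magma X)"
    by (simp add: edge_magma_def)
next
  fix i j k assume ijk: "i \<le> n" "j \<le> n" "k \<le> n"
  \<comment> \<open>The face of \<open>x\<close> with vertices \<open>i\<close>, \<open>j\<close>, \<open>k\<close> witnesses the product.\<close>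
  define t where "t = (\<lambda>l \<in> {..2::nat}. if l = 0 then i else if l = 1 then j else k)"
  have t: "t \<in> {..2} \<rightarrow>\<^sub>E {..n}" using ijk by (auto simp: t_def)
  have "t 0 = i" "t 1 = j" "t 2 = k" by (simp_all add: t_def)
  then show "pmult (edge_magma X) (edge X n x i j) (edge X n x j k) = Some (edge X n x i k)"
    unfolding pmult_edge_magma using act_closed[OF t x] edge_act[OF t x]
    by (intro bexI[of _ "fmor X n 2 t x"]) simp_all
qed

text \<open>
  All axioms are instances of the coherence of edges: the inverse of an edge is the reversed edge,
  and for a 2-simplex with edges \<open>a = (0, 1)\<close>, \<open>b = (1, 2)\<close> and \<open>c = (0, 2)\<close> the cancellation
  laws are the products along the vertices \<open>1, 0, 2\<close> and \<open>0, 2, 1\<close>.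
\<close>

lemma binary_partial_group_edge_magma: "binary_partial_group (edge_magma X)"
proof -
  have mult_edge: "pmult (edge_magma X) (edge X n x i j) (edge X n x j k) = Some (edge X n x i k)"
    and edge_one: "edge X n x i i = pone (edge_magma X)"
    if "x \<in> fob X n" "i \<le> n" "j \<le> n" "k \<le> n" for n x i j k
    using coherent_edge[OF that(1)] that(2-) by (simp_all add: coherent_def)
  show ?thesis
  proof
    fix a b c
    assume "pmult (edge_magma X) a b = Some c"
    then show "a \<in> pcarrier (edge_magma X) \<and> b \<in> pcarrier (edge_magma X)
        \<and> c \<in> pcarrier (edge_magma X)"
      by (auto simp: pmult_edge_magma pcarrier_edge_magma edge_closed simp del: One_nat_def)
  next
    obtain v where "v \<in> fob X 0" using reduced by (auto simp: reduced_def)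
    then show "pone (edge_magma X) \<in> pcarrier (edge_magma X)"
      using edge_one[of v 0 0] edge_closed[of v 0 0 0] by (simp add: pcarrier_edge_magma)
  next
    fix a assume "a \<in> pcarrier (edge_magma X)"
    then have a: "a \<in> fob X 1" by (simp add: pcarrier_edge_magma)
    show "pmult (edge_magma X) a (pone (edge_magma X)) = Some a"
      using mult_edge[OF a, of 0 1 1] edge_one[OF a, of 1 1 1] edge_0_1[OF a] by simp
    show "pmult (edge_magma X) (pone (edge_magma X)) a = Some a"
      using mult_edge[OF a, of 0 0 1] edge_one[OF a, of 0 0 0] edge_0_1[OF a] by simp
    have a': "edge X n y j i = edge X 1 a 1 0"
      if "y \<in> fob X n" "i \<le> n" "j \<le> n" "edge X n y i j = a" for n y i j
      using edge_act[OF edge_map_in[OF that(2,3)] that(1), of 1 0] that(4)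
      by (simp add: edge_def) (simp add: edge_map_def)
    show "\<exists>a' \<in> pcarrier (edge_magma X). \<forall>b \<in> pcarrier (edge_magma X).
      (\<forall>c. pmult (edge_magma X) a b = Some c \<longrightarrow> pmult (edge_magma X) a' c = Some b) \<and>
      (\<forall>c. pmult (edge_magma X) b a = Some c \<longrightarrow> pmult (edge_magma X) c a' = Some b)"
    proof (intro bexI[of _ "edge X 1 a 1 0"] ballI conjI allI impI)
      fix b c assume "pmult (edge_magma X) a b = Some c"
      then obtain y where "y \<in> fob X 2" "edge X 2 y 0 1 = a" "edge X 2 y 1 2 = b"
        "edge X 2 y 0 2 = c"
        by (auto simp: pmult_edge_magma)
      then show "pmult (edge_magma X) (edge X 1 a 1 0) c = Some b"
        using mult_edge[of y 2 1 0 2] a'[of y 2 0 1] by simp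
    next
      fix b c assume "pmult (edge_magma X) b a = Some c"
      then obtain y where "y \<in> fob X 2" "edge X 2 y 0 1 = b" "edge X 2 y 1 2 = a"
        "edge X 2 y 0 2 = c"
        by (auto simp: pmult_edge_magma)
      then show "pmult (edge_magma X) c (edge X 1 a 1 0) = Some b"
        using mult_edge[of y 2 0 2 1] a'[of y 2 1 2] by simp
    qed (simp add: pcarrier_edge_magma edge_closed a del: One_nat_def)
  qed
qed

end

text \<open>
  The functor that realises the equivalence.
\<close>

definition edge_functor ::
  "('u symset, nat \<Rightarrow> 'u \<Rightarrow> 'u, 'u partial_magma, 'u \<Rightarrow> 'u) cfunctor" where
  "edge_functor = \<lparr>fob = edge_magma, fmor = (\<lambda>X Y t. t 1)\<rparr>"

lemma is_functor_edge_functor: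
  "is_functor two_skeletal_partial_groups binary_partial_groups edge_functor"
proof (intro is_functor.intro is_functor_axioms.intro category_two_skeletal_partial_groups
    category_binary_partial_groups)
  show "fob edge_functor X \<in> Ob binary_partial_groups"
    if "X \<in> Ob two_skeletal_partial_groups" for X :: "'u symset"
    using that
    by (simp add: Ob_two_skeletal edge_functor_def binary_partial_groups_def
        partial_group.binary_partial_group_edge_magma)
next
  fix X Y :: "'u symset" and t
  assume "X \<in> Ob two_skeletal_partial_groups" "Y \<in> Ob two_skeletal_partial_groups"
    and t: "t \<in> Hom two_skeletal_partial_groups X Y"
  then interpret X: partial_group X + Y: partial_group Y
    by (simp_all add: Ob_two_skeletal)
  note sym = X.symmetric_set_axioms Y.symmetric_set_axioms
  have t: "t \<in> Hom symmetric_sets X Y"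
    using t by (simp add: Hom_two_skeletal)
  then have tn: "t n \<in> fob X n \<rightarrow>\<^sub>E fob Y n" for n
    by (simp add: Hom_symmetric_sets[OF sym])
  show "fmor edge_functor X Y t
      \<in> Hom binary_partial_groups (fob edge_functor X) (fob edge_functor Y)"
    unfolding edge_functor_def binary_partial_groups_def bpg_hom_def
  proof (simp add: X.pcarrier_edge_magma Y.pcarrier_edge_magma tn[of 1, simplified], intro ballI allI impI)
    fix a b c assume "pmult (edge_magma X) a b = Some c"
    then obtain y where y: "y \<in> fob X 2" "edge X 2 y 0 1 = a" "edge X 2 y 1 2 = b"
      "edge X 2 y 0 2 = c"
      by (auto simp: X.pmult_edge_magma)
    have "t 2 y \<in> fob Y 2" using tn[of 2] y by blast
    then show "pmult (edge_magma Y) (t (Suc 0) a) (t (Suc 0) b) = Some (t (Suc 0) c)"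
      unfolding Y.pmult_edge_magma using y edge_Hom[OF sym t y(1)]
      by (intro bexI[of _ "t 2 y"]) simp_all
  qed
qed (simp_all add: edge_functor_def Ident_two_skeletal Comp_two_skeletal
    binary_partial_groups_def edge_magma_def)

section \<open>Coherent matrices in a binary partial group\<close>

context binary_partial_group
begin

text \<open>
  The inverse \<open>a\<^sup>\<dagger>\<close>; it is unique by \<open>inverse_unique\<close> below.
\<close>

definition inverse_elem :: "'a \<Rightarrow> 'a" where
  "inverse_elem a = (SOME a'. a' \<in> pcarrier P \<and> (\<forall>b \<in> pcarrier P.
    (\<forall>c. pmult P a b = Some c \<longrightarrow> pmult P a' c = Some b) \<and>
    (\<forall>c. pmult P b a = Some c \<longrightarrow> pmult P c a' = Some b)))"

lemma inverse_elem:
  assumes "a \<in> pcarrier P"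
  shows inverse_closed: "inverse_elem a \<in> pcarrier P"
    and cancel_left: "pmult P a b = Some c \<Longrightarrow> pmult P (inverse_elem a) c = Some b"
    and cancel_right: "pmult P b a = Some c \<Longrightarrow> pmult P c (inverse_elem a) = Some b"
proof -
  have "\<exists>a'. a' \<in> pcarrier P \<and> (\<forall>b \<in> pcarrier P.
      (\<forall>c. pmult P a b = Some c \<longrightarrow> pmult P a' c = Some b) \<and>
      (\<forall>c. pmult P b a = Some c \<longrightarrow> pmult P c a' = Some b))"
    using ex_inverse[OF assms] by blast
  from someI_ex[OF this, folded inverse_elem_def]
  show "inverse_elem a \<in> pcarrier P"
    "pmult P a b = Some c \<Longrightarrow> pmult P (inverse_elem a) c = Some b"
    "pmult P b a = Some c \<Longrightarrow> pmult P c (inverse_elem a) = Some b"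
    using mult_closed[of a b c] mult_closed[of b a c] by blast+
qed

lemma mult_inverse: "a \<in> pcarrier P \<Longrightarrow> pmult P a (inverse_elem a) = Some (pone P)"
  by (simp add: cancel_right one_mult)

lemma inverse_mult: "a \<in> pcarrier P \<Longrightarrow> pmult P (inverse_elem a) a = Some (pone P)"
  by (simp add: cancel_left mult_one)

lemma inverse_unique:
  assumes "pmult P a b = Some (pone P)"
  shows "b = inverse_elem a"
  using cancel_left[OF _ assms] mult_closed[OF assms] by (simp add: mult_one inverse_closed)

lemma idempotent_imp_one:
  assumes "pmult P a a = Some a"
  shows "a = pone P"
  using cancel_left[OF _ assms] inverse_mult mult_closed[OF assms] by simp

lemma coherent_closed: "\<lbrakk>coherent P n m; i \<le> n; j \<le> n\<rbrakk> \<Longrightarrow> m i j \<in> pcarrier P"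
  unfolding coherent_def using mult_closed by blast

lemma coherent_swap:
  assumes "coherent P n m" "i \<le> n" "j \<le> n"
  shows "m j i = inverse_elem (m i j)"
proof -
  have "pmult P (m i j) (m j i) = Some (pone P)"
    using assms unfolding coherent_def by metis
  then show ?thesis by (rule inverse_unique)
qed

text \<open>
  Entries above the diagonal are iterated products of the spine, by induction on the distance from
  the diagonal, and those below it are inverses of entries above it.
\<close>

lemma coherent_eqI:
  assumes m: "coherent P n m" "coherent P n m'"
    and spine: "\<And>i. i < n \<Longrightarrow> m i (Suc i) = m' i (Suc i)"
    and ij: "i \<le> n" "j \<le> n"
  shows "m i j = m' i j"
proof -
  have upper: "m i (i + d) = m' i (i + d)" if "i + d \<le> n" for i d
    using that
  proof (induction d)
    case 0
    then show ?case using m by (simp add: coherent_def)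
  next
    case (Suc d)
    have "Some (m i (i + Suc d)) = pmult P (m i (i + d)) (m (i + d) (i + Suc d))"
      using m(1) Suc.prems by (simp add: coherent_def)
    also have "\<dots> = pmult P (m' i (i + d)) (m' (i + d) (i + Suc d))"
      using Suc spine by simp
    also have "\<dots> = Some (m' i (i + Suc d))"
      using m(2) Suc.prems by (simp add: coherent_def)
    finally show ?case by simp
  qed
  show ?thesis
  proof (cases "i \<le> j")
    case True
    then show ?thesis using upper[of i "j - i"] ij by simp
  next
    case False
    then have "m j i = m' j i" using upper[of j "i - j"] ij by simp
    then show ?thesis
      using coherent_swap[OF m(1) ij(2,1)] coherent_swap[OF m(2) ij(2,1)] by simp
  qed
qed

lemma ex_coherent_triangle:
  assumes ab: "pmult P a b = Some c"
  obtains w where "coherent P 2 w" "w 0 1 = a" "w 1 2 = b" "w 0 2 = c"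
proof
  define w :: "nat \<Rightarrow> nat \<Rightarrow> 'a" where "w = (\<lambda>i j. if i = j then pone P
    else if i = 0 then (if j = 1 then a else c)
    else if i = 1 then (if j = 0 then inverse_elem a else b)
    else (if j = 0 then inverse_elem c else inverse_elem b))"
  have abc: "a \<in> pcarrier P" "b \<in> pcarrier P" "c \<in> pcarrier P"
    using mult_closed[OF ab] by auto
  note inv = abc[THEN inverse_closed]
  \<comment> \<open>Cancellation turns \<open>a b = c\<close> into the products along the other orders of the vertices.\<close>
  have "pmult P (inverse_elem a) c = Some b"
    using cancel_left[OF abc(1) ab] .
  moreover have "pmult P c (inverse_elem b) = Some a"
    using cancel_right[OF abc(2) ab] .
  moreover from this have "pmult P (inverse_elem c) a = Some (inverse_elem b)"
    using cancel_left[OF abc(3)] by blast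
  moreover from this have "pmult P (inverse_elem b) (inverse_elem a) = Some (inverse_elem c)"
    using cancel_right[OF abc(1)] by blast
  moreover from calculation(1) have "pmult P b (inverse_elem c) = Some (inverse_elem a)"
    using cancel_right[OF abc(3)] by blast
  ultimately have mult: "pmult P (w i j) (w j k) = Some (w i k)"
    if "i \<in> {0, 1, 2}" "j \<in> {0, 1, 2}" "k \<in> {0, 1, 2}" for i j k
    using that abc inv ab
    by (auto simp: w_def mult_one one_mult one_closed mult_inverse inverse_mult)
  have "i \<in> {0, 1, 2}" if "i \<le> 2" for i :: nat
    using that by auto
  then have "pmult P (w i j) (w j k) = Some (w i k)" if "i \<le> 2" "j \<le> 2" "k \<le> 2" for i j k
    using mult that by presburger
  then show "coherent P 2 w"
    by (simp add: coherent_def w_def)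
  show "w 0 1 = a" "w 1 2 = b" "w 0 2 = c" by (simp_all add: w_def)
qed

end

lemma coherent_hom:
  assumes "binary_partial_group P" "binary_partial_group Q" "f \<in> bpg_hom P Q" "coherent P n m"
  shows "coherent Q n (\<lambda>i j. f (m i j))"
proof -
  interpret P: binary_partial_group P by fact
  interpret Q: binary_partial_group Q by fact
  have mult: "pmult Q (f a) (f b) = Some (f c)" if "pmult P a b = Some c" for a b c
    using assms(3) that P.mult_closed[OF that] by (auto simp: bpg_hom_def)
  have "f (pone P) = pone Q"
    by (rule Q.idempotent_imp_one[OF mult]) (simp add: P.mult_one P.one_closed)
  then show ?thesis
    using assms(4) mult by (simp add: coherent_def)
qed

lemma isomorphism_binary_partial_groups:
  assumes "binary_partial_group Q"
    and f: "f \<in> bpg_hom P Q" and bij: "bij_betw f (pcarrier P) (pcarrier Q)"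
    and reflect: "\<And>a b c. \<lbrakk>a \<in> pcarrier P; b \<in> pcarrier P; c \<in> pcarrier P;
      pmult Q (f a) (f b) = Some (f c)\<rbrakk> \<Longrightarrow> pmult P a b = Some c"
  shows "isomorphism binary_partial_groups P Q f"
proof -
  interpret Q: binary_partial_group Q by fact
  define g where "g = (\<lambda>y \<in> pcarrier Q. inv_into (pcarrier P) f y)"
  have g: "g y \<in> pcarrier P" "f (g y) = y" if "y \<in> pcarrier Q" for y
    using that bij unfolding g_def bij_betw_def
    by (simp_all add: inv_into_into f_inv_into_f)
  have gf: "g (f x) = x" "f x \<in> pcarrier Q" if "x \<in> pcarrier P" for x
    using that bij unfolding g_def by (auto simp: bij_betw_def)
  have "g \<in> bpg_hom Q P"
    unfolding bpg_hom_def
  proof (intro CollectI conjI ballI allI impI)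
    show "g \<in> pcarrier Q \<rightarrow>\<^sub>E pcarrier P"
      using g(1) by (auto simp: g_def)
    fix a b c assume ab: "a \<in> pcarrier Q" "b \<in> pcarrier Q" "pmult Q a b = Some c"
    then have "c \<in> pcarrier Q"
      using Q.mult_closed by blast
    then show "pmult P (g a) (g b) = Some (g c)"
      using ab by (intro reflect) (simp_all add: g)
  qed
  moreover have "compose (pcarrier P) g f = (\<lambda>x \<in> pcarrier P. x)"
    unfolding compose_def by (rule restrict_ext) (rule gf(1))
  moreover have "compose (pcarrier Q) f g = (\<lambda>x \<in> pcarrier Q. x)"
    unfolding compose_def by (rule restrict_ext) (rule g(2))
  ultimately show ?thesis
    using f by (auto simp: isomorphism_def binary_partial_groups_def)
qed

section \<open>Two-skeletal symmetric sets\<close>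

text \<open>
  Simplices of dimension 0 and 1 also come from 2-simplices, as \<open>[k]\<close> is a retract of \<open>[2]\<close>
  for \<open>k \<le> 2\<close>. Hence the simplices of the form \<open>\<alpha>\<^sup>* y\<close> with \<open>y\<close> in \<open>X\<^sub>2\<close> form the 2-skeleton.
\<close>

lemma two_skeletal_iff:
  assumes "symmetric_set X"
  shows "two_skeletal X \<longleftrightarrow>
    (\<forall>n. \<forall>x \<in> fob X n. \<exists>\<alpha> \<in> {..n} \<rightarrow>\<^sub>E {..2}. \<exists>y \<in> fob X 2. x = fmor X 2 n \<alpha> y)"
    (is "_ \<longleftrightarrow> ?R")
proof -
  interpret symmetric_set X by fact
  define S where "S n = {fmor X 2 n \<alpha> y | \<alpha> y. \<alpha> \<in> {..n} \<rightarrow>\<^sub>E {..2} \<and> y \<in> fob X 2}" for n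
  have comp: "compose {..l} \<alpha> \<beta> \<in> {..l} \<rightarrow>\<^sub>E {..k}"
    if "\<alpha> \<in> {..m} \<rightarrow>\<^sub>E {..k}" "\<beta> \<in> {..l} \<rightarrow>\<^sub>E {..m}" for \<alpha> \<beta> k l m
    using that by (auto simp: compose_def)
  have "symmetric_subset X S"
    unfolding symmetric_subset_def
  proof (intro conjI allI ballI subsetI)
    fix n x assume "x \<in> S n"
    then show "x \<in> fob X n" by (auto simp: S_def act_closed)
  next
    fix m n \<alpha> x assume "\<alpha> \<in> Hom upsilon m n" "x \<in> fmor X n m \<alpha> ` S n"
    then obtain \<beta> y where "\<alpha> \<in> {..m} \<rightarrow>\<^sub>E {..n}" "\<beta> \<in> {..n} \<rightarrow>\<^sub>E {..2}" "y \<in> fob X 2"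
      "x = fmor X n m \<alpha> (fmor X 2 n \<beta> y)"
      by (auto simp: S_def upsilon_def)
    then show "x \<in> S m"
      using act_act comp unfolding S_def by blast
  qed
  moreover have "fob X k \<subseteq> S k" if "k \<le> 2" for k
  proof
    fix x assume x: "x \<in> fob X k"
    define \<iota> where "\<iota> = (\<lambda>i \<in> {..k}. i)"
    define \<rho> where "\<rho> = (\<lambda>i \<in> {..2}. min i k)"
    have \<iota>\<rho>: "\<iota> \<in> {..k} \<rightarrow>\<^sub>E {..2}" "\<rho> \<in> {..2} \<rightarrow>\<^sub>E {..k}"
      using that by (auto simp: \<iota>_def \<rho>_def)
    have "compose {..k} \<rho> \<iota> = (\<lambda>i \<in> {..k}. i)"
      using that by (auto simp: compose_def \<iota>_def \<rho>_def fun_eq_iff)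
    then have "x = fmor X 2 k \<iota> (fmor X k 2 \<rho> x)"
      using act_act[OF \<iota>\<rho>(2,1) x] act_id[OF x] by simp
    then show "x \<in> S k"
      unfolding S_def using \<iota>\<rho> act_closed[OF \<iota>\<rho>(2) x] by blast
  qed
  ultimately have skel_S: "skeleton2 X n \<subseteq> S n" for n
    unfolding skeleton2_def by blast
  have S_skel: "S n \<subseteq> skeleton2 X n" for n
  proof
    fix x assume "x \<in> S n"
    then obtain \<alpha> y where \<alpha>: "\<alpha> \<in> Hom upsilon n 2" and y: "y \<in> fob X 2" and x: "x = fmor X 2 n \<alpha> y"
      by (auto simp: S_def upsilon_def)
    have "x \<in> T n" if "symmetric_subset X T" "\<forall>k \<le> 2. fob X k \<subseteq> T k" for T
    proof -
      have "y \<in> T 2" using that(2) y by blast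
      then show "x \<in> T n"
        using that(1) \<alpha> unfolding symmetric_subset_def x by blast
    qed
    then show "x \<in> skeleton2 X n"
      unfolding skeleton2_def by blast
  qed
  have "S n \<subseteq> fob X n" for n
    by (auto simp: S_def act_closed)
  then have "two_skeletal X \<longleftrightarrow> (\<forall>n. fob X n \<subseteq> S n)"
    unfolding two_skeletal_def using skel_S S_skel by blast
  also have "\<dots> \<longleftrightarrow> ?R"
    unfolding S_def by blast
  finally show ?thesis .
qed

section \<open>The edge functor is fully faithful\<close>

lemma edge_functor_faithful:
  assumes "partial_group X" "partial_group Y"
    and s: "s \<in> Hom symmetric_sets X Y" and t: "t \<in> Hom symmetric_sets X Y"
    and st: "s 1 = t 1"
  shows "s = t"
proof (intro ext)
  interpret X: partial_group X by fact
  interpret Y: partial_group Y by fact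
  note sym = X.symmetric_set_axioms Y.symmetric_set_axioms
  fix n x
  have sn: "s n \<in> fob X n \<rightarrow>\<^sub>E fob Y n" and tn: "t n \<in> fob X n \<rightarrow>\<^sub>E fob Y n"
    using s t by (simp_all add: Hom_symmetric_sets[OF sym])
  show "s n x = t n x"
  proof (cases "x \<in> fob X n")
    case True
    show ?thesis
    proof (rule Y.simplex_eqI)
      show "s n x \<in> fob Y n" "t n x \<in> fob Y n" using True sn tn by blast+
      show "edge Y n (s n x) i (Suc i) = edge Y n (t n x) i (Suc i)" if "i < n" for i
        using that st by (simp add: edge_Hom[OF sym s True] edge_Hom[OF sym t True])
    qed
  next
    case False
    then show ?thesis using PiE_arb[OF sn] PiE_arb[OF tn] by simp
  qed
qed

lemma edge_functor_full:
  assumes "partial_group X" "partial_group Y" "two_skeletal X"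
    and f: "f \<in> bpg_hom (edge_magma X) (edge_magma Y)"
  obtains t where "t \<in> Hom symmetric_sets X Y" "t 1 = f"
proof -
  interpret X: partial_group X by fact
  interpret Y: partial_group Y by fact
  interpret FY: binary_partial_group "edge_magma Y"
    by (rule Y.binary_partial_group_edge_magma)
  have f_edge: "coherent (edge_magma Y) n (\<lambda>i j. f (edge X n x i j))" if "x \<in> fob X n" for n x
    using coherent_hom[OF X.binary_partial_group_edge_magma Y.binary_partial_group_edge_magma f
      X.coherent_edge[OF that]] .
  have f_ext: "f \<in> fob X 1 \<rightarrow>\<^sub>E fob Y 1"
    using f by (simp add: bpg_hom_def X.pcarrier_edge_magma Y.pcarrier_edge_magma)
  have image2: "\<exists>w \<in> fob Y 2. \<forall>i \<le> 2. \<forall>j \<le> 2. edge Y 2 w i j = f (edge X 2 z i j)"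
    if z: "z \<in> fob X 2" for z
  proof -
    have "pmult (edge_magma Y) (f (edge X 2 z 0 1)) (f (edge X 2 z 1 2)) = Some (f (edge X 2 z 0 2))"
      using f_edge[OF z] by (simp add: coherent_def)
    then obtain w where w: "w \<in> fob Y 2" "edge Y 2 w 0 1 = f (edge X 2 z 0 1)"
      "edge Y 2 w 1 2 = f (edge X 2 z 1 2)"
      by (auto simp: Y.pmult_edge_magma)
    have "edge Y 2 w i j = f (edge X 2 z i j)" if "i \<le> 2" "j \<le> 2" for i j
    proof (rule FY.coherent_eqI[OF Y.coherent_edge[OF w(1)] f_edge[OF z] _ that])
      fix i :: nat assume "i < 2"
      then have "i = 0 \<or> i = 1" by linarith
      then show "edge Y 2 w i (Suc i) = f (edge X 2 z i (Suc i))"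
        using w by (auto simp: numeral_2_eq_2)
    qed
    then show ?thesis using w(1) by blast
  qed
  have image: "\<exists>y \<in> fob Y n. \<forall>i \<le> n. \<forall>j \<le> n. edge Y n y i j = f (edge X n x i j)"
    if x: "x \<in> fob X n" for n x
  proof -
    obtain \<alpha> z where \<alpha>: "\<alpha> \<in> {..n} \<rightarrow>\<^sub>E {..2}" and z: "z \<in> fob X 2" and xz: "x = fmor X 2 n \<alpha> z"
      using assms(3) x unfolding two_skeletal_iff[OF X.symmetric_set_axioms] by blast
    obtain w where w: "w \<in> fob Y 2" "\<And>i j. \<lbrakk>i \<le> 2; j \<le> 2\<rbrakk> \<Longrightarrow> edge Y 2 w i j = f (edge X 2 z i j)"
      using image2[OF z] by blast
    have "\<alpha> i \<le> 2" if "i \<le> n" for i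
      using \<alpha> that by auto
    then show ?thesis
      using w \<alpha> z by (intro bexI[of _ "fmor Y 2 n \<alpha> w"])
        (simp_all add: xz X.edge_act Y.edge_act Y.act_closed)
  qed
  define t where "t n = (\<lambda>x \<in> fob X n. SOME y. y \<in> fob Y n \<and>
    (\<forall>i \<le> n. \<forall>j \<le> n. edge Y n y i j = f (edge X n x i j)))" for n
  have t_closed: "t n x \<in> fob Y n"
    and edge_t: "\<lbrakk>i \<le> n; j \<le> n\<rbrakk> \<Longrightarrow> edge Y n (t n x) i j = f (edge X n x i j)"
    if "x \<in> fob X n" for n x i j
  proof -
    have "\<exists>y. y \<in> fob Y n \<and> (\<forall>i \<le> n. \<forall>j \<le> n. edge Y n y i j = f (edge X n x i j))"
      using image[OF that] by blast
    from someI_ex[OF this] that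
    show "t n x \<in> fob Y n" "\<lbrakk>i \<le> n; j \<le> n\<rbrakk> \<Longrightarrow> edge Y n (t n x) i j = f (edge X n x i j)"
      by (simp_all add: t_def)
  qed
  have "t m (fmor X n m \<alpha> x) = fmor Y n m \<alpha> (t n x)"
    if \<alpha>: "\<alpha> \<in> {..m} \<rightarrow>\<^sub>E {..n}" and x: "x \<in> fob X n" for n m \<alpha> x
  proof (rule Y.simplex_eqI)
    fix i assume "i < m"
    then have "i \<le> m" "Suc i \<le> m" "\<alpha> i \<le> n" "\<alpha> (Suc i) \<le> n"
      using \<alpha> by auto
    then show "edge Y m (t m (fmor X n m \<alpha> x)) i (Suc i) =
        edge Y m (fmor Y n m \<alpha> (t n x)) i (Suc i)"
      using \<alpha> x by (simp add: edge_t X.act_closed t_closed X.edge_act Y.edge_act)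
  qed (use \<alpha> x in \<open>simp_all add: t_closed X.act_closed Y.act_closed\<close>)
  moreover have "t n \<in> fob X n \<rightarrow>\<^sub>E fob Y n" for n
    using t_closed by (auto simp: t_def)
  ultimately have "t \<in> Hom symmetric_sets X Y"
    by (simp add: Hom_symmetric_sets[OF X.symmetric_set_axioms Y.symmetric_set_axioms])
  moreover have "t 1 = f"
  proof
    fix a
    show "t 1 a = f a"
    proof (cases "a \<in> fob X 1")
      case True
      then show ?thesis
        using edge_t[OF True, of 0 1] Y.edge_0_1[OF t_closed[OF True]] X.edge_0_1[OF True] by simp
    next
      case False
      then show ?thesis using PiE_arb[OF f_ext] by (simp add: t_def)
    qed
  qed
  ultimately show ?thesis using that by blast
qed

section \<open>The two-skeletal nerve of a binary partial group\<close>

text \<open>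
  By induction on \<open>A\<close>, combining the values one at a time with an injective pairing on \<open>'u\<close>.
\<close>

lemma ex_inj_on_functions:
  assumes "finite A" "infinite (UNIV :: 'u set)"
  shows "\<exists>e :: ('i \<Rightarrow> 'u) \<Rightarrow> 'u. inj_on e (A \<rightarrow>\<^sub>E UNIV)"
  using assms(1)
proof (induction A)
  case empty
  then show ?case by simp
next
  case (insert a A)
  then obtain e :: "('i \<Rightarrow> 'u) \<Rightarrow> 'u" where e: "inj_on e (A \<rightarrow>\<^sub>E UNIV)" by blast
  obtain p :: "'u \<times> 'u \<Rightarrow> 'u" where p: "inj p"
    using card_of_Times_same_infinite[OF assms(2)] card_of_ordIso[of "UNIV \<times> UNIV" "UNIV :: 'u set"]
    by (auto simp: bij_betw_def)
  have "inj_on (\<lambda>f. p (f a, e (restrict f A))) (insert a A \<rightarrow>\<^sub>E UNIV)"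
  proof (rule inj_onI)
    fix f g :: "'i \<Rightarrow> 'u"
    assume fg: "f \<in> insert a A \<rightarrow>\<^sub>E UNIV" "g \<in> insert a A \<rightarrow>\<^sub>E UNIV"
      and "p (f a, e (restrict f A)) = p (g a, e (restrict g A))"
    then have "f a = g a" "e (restrict f A) = e (restrict g A)"
      using injD[OF p] by blast+
    moreover from this have "restrict f A = restrict g A"
      using e by (auto dest: inj_onD)
    ultimately have "f x = g x" if "x \<in> insert a A" for x
      using that by (metis insertE restrict_apply)
    then show "f = g"
      using fg by (intro PiE_ext)
  qed
  then show ?case by blast
qed

text \<open>
  A binary partial group with a family of codes in \<open>'u\<close> for the matrices on \<open>[n]\<close>, which are
  represented as extensional functions on pairs.
\<close>

locale encoded_nerve = binary_partial_group P for P :: "'u partial_magma" +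
  fixes enc :: "nat \<Rightarrow> (nat \<times> nat \<Rightarrow> 'u) \<Rightarrow> 'u"
  assumes inj_enc: "inj_on (enc n) ({..n} \<times> {..n} \<rightarrow>\<^sub>E UNIV)"
begin

text \<open>
  The matrices on \<open>[n]\<close> that are pulled back from a coherent matrix on \<open>[2]\<close>. They are coherent,
  but for \<open>n \<ge> 3\<close> a coherent matrix need not be of this form; admitting only these makes the
  nerve 2-skeletal.
\<close>

definition matrices :: "nat \<Rightarrow> (nat \<times> nat \<Rightarrow> 'u) set" where
  "matrices n = {m \<in> extensional ({..n} \<times> {..n}). \<exists>\<alpha> \<in> {..n} \<rightarrow>\<^sub>E {..2}. \<exists>w. coherent P 2 w \<and>
    (\<forall>i \<le> n. \<forall>j \<le> n. m (i, j) = w (\<alpha> i) (\<alpha> j))}"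

text \<open>
  The matrix \<open>\<alpha>\<^sup>* m\<close> on \<open>[l]\<close>, for \<open>\<alpha> : [l] \<rightarrow> [n]\<close> and a matrix \<open>m\<close> on \<open>[n]\<close>.
\<close>

definition pullback :: "(nat \<Rightarrow> nat) \<Rightarrow> nat \<Rightarrow> (nat \<times> nat \<Rightarrow> 'u) \<Rightarrow> nat \<times> nat \<Rightarrow> 'u" where
  "pullback \<alpha> l m = (\<lambda>(i, j) \<in> {..l} \<times> {..l}. m (\<alpha> i, \<alpha> j))"

text \<open>
  The matrix with a given code.
\<close>

definition dec :: "nat \<Rightarrow> 'u \<Rightarrow> nat \<times> nat \<Rightarrow> 'u" where
  "dec n = inv_into (matrices n) (enc n)"

text \<open>
  The symmetric set with the codes of \<^term>\<open>matrices n\<close> as \<open>n\<close>-simplices, on which maps act by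
  pullback.
\<close>

definition nerve :: "'u symset" where
  "nerve = \<lparr>fob = (\<lambda>n. enc n ` matrices n),
    fmor = (\<lambda>n l. \<lambda>\<alpha> \<in> {..l} \<rightarrow>\<^sub>E {..n}. \<lambda>x \<in> enc n ` matrices n. enc l (pullback \<alpha> l (dec n x)))\<rparr>"

lemma dec_enc: "m \<in> matrices n \<Longrightarrow> dec n (enc n m) = m"
  unfolding dec_def
  by (intro inv_into_f_f inj_on_subset[OF inj_enc]) (auto simp: matrices_def PiE_def)

lemma pullback_matrices:
  assumes m: "m \<in> matrices n" and \<alpha>: "\<alpha> \<in> {..l} \<rightarrow>\<^sub>E {..n}"
  shows "pullback \<alpha> l m \<in> matrices l"
proof -
  obtain \<beta> w where \<beta>: "\<beta> \<in> {..n} \<rightarrow>\<^sub>E {..2}" and w: "coherent P 2 w"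
    and mw: "\<And>i j. \<lbrakk>i \<le> n; j \<le> n\<rbrakk> \<Longrightarrow> m (i, j) = w (\<beta> i) (\<beta> j)"
    using m by (auto simp: matrices_def)
  have le: "\<alpha> i \<le> n" if "i \<le> l" for i
    using \<alpha> that by auto
  have "compose {..l} \<beta> \<alpha> \<in> {..l} \<rightarrow>\<^sub>E {..2}"
    using \<alpha> \<beta> by (auto simp: compose_def)
  moreover have "pullback \<alpha> l m (i, j) = w (compose {..l} \<beta> \<alpha> i) (compose {..l} \<beta> \<alpha> j)"
    if "i \<le> l" "j \<le> l" for i j
    using that le by (simp add: pullback_def mw compose_def)
  ultimately show ?thesis
    using w by (auto simp: matrices_def pullback_def)
qed

lemma coherent_matrices: "m \<in> matrices n \<Longrightarrow> coherent P n (\<lambda>i j. m (i, j))"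
proof -
  assume "m \<in> matrices n"
  then obtain \<alpha> w where "\<alpha> \<in> {..n} \<rightarrow>\<^sub>E {..2}" "coherent P 2 w"
    "\<And>i j. \<lbrakk>i \<le> n; j \<le> n\<rbrakk> \<Longrightarrow> m (i, j) = w (\<alpha> i) (\<alpha> j)"
    by (auto simp: matrices_def)
  then show ?thesis
    using coherent_pullback[of P 2 w \<alpha> n]
      coherent_cong[of n "\<lambda>i j. m (i, j)" "\<lambda>i j. w (\<alpha> i) (\<alpha> j)"] by simp
qed

lemma matrices_2:
  assumes "coherent P 2 w"
  shows "(\<lambda>(i, j) \<in> {..2} \<times> {..2}. w i j) \<in> matrices 2"
  unfolding matrices_def using assms
  by (intro CollectI conjI bexI[of _ "\<lambda>i \<in> {..2}. i"] exI[of _ w]) auto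

lemma fob_nerve: "fob nerve n = enc n ` matrices n"
  by (simp add: nerve_def)

lemma act_nerve:
  "\<lbrakk>\<alpha> \<in> {..l} \<rightarrow>\<^sub>E {..n}; m \<in> matrices n\<rbrakk> \<Longrightarrow> fmor nerve n l \<alpha> (enc n m) = enc l (pullback \<alpha> l m)"
  by (simp add: nerve_def dec_enc)

lemma matrices_eqI:
  assumes "m \<in> matrices n" "m' \<in> matrices n" "\<And>i. i < n \<Longrightarrow> m (i, Suc i) = m' (i, Suc i)"
  shows "m = m'"
proof -
  have "m (i, j) = m' (i, j)" if "i \<le> n" "j \<le> n" for i j
    using coherent_eqI[OF coherent_matrices coherent_matrices, OF assms that] .
  then show ?thesis
    using assms(1,2) by (intro extensionalityI[of _ "{..n} \<times> {..n}"]) (auto simp: matrices_def)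
qed

lemma symmetric_set_nerve: "symmetric_set nerve"
proof
  show "fmor nerve n l \<alpha> x \<in> fob nerve l"
    if "\<alpha> \<in> {..l} \<rightarrow>\<^sub>E {..n}" "x \<in> fob nerve n" for \<alpha> l n x
    using that by (auto simp: fob_nerve act_nerve pullback_matrices)
  show "fmor nerve n n (\<lambda>i \<in> {..n}. i) x = x" if x: "x \<in> fob nerve n" for n x
  proof -
    obtain m where m: "m \<in> matrices n" "x = enc n m" using x by (auto simp: fob_nerve)
    have "pullback (\<lambda>i \<in> {..n}. i) n m = m"
      using m(1) by (auto simp: pullback_def matrices_def extensional_def fun_eq_iff)
    then show ?thesis using m by (simp add: act_nerve)
  qed
  show "fmor nerve m l \<beta> (fmor nerve n m \<alpha> x) = fmor nerve n l (compose {..l} \<alpha> \<beta>) x"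
    if \<alpha>: "\<alpha> \<in> {..m} \<rightarrow>\<^sub>E {..n}" and \<beta>: "\<beta> \<in> {..l} \<rightarrow>\<^sub>E {..m}" and x: "x \<in> fob nerve n"
    for \<alpha> \<beta> l m n x
  proof -
    obtain M where M: "M \<in> matrices n" "x = enc n M" using x by (auto simp: fob_nerve)
    have comp: "compose {..l} \<alpha> \<beta> \<in> {..l} \<rightarrow>\<^sub>E {..n}"
      using \<alpha> \<beta> by (auto simp: compose_def)
    have "\<beta> i \<le> m" if "i \<le> l" for i using \<beta> that by auto
    then have "pullback \<beta> l (pullback \<alpha> m M) = pullback (compose {..l} \<alpha> \<beta>) l M"
      by (auto simp: pullback_def compose_def fun_eq_iff)
    then show ?thesis
      using M \<alpha> \<beta> comp by (simp add: act_nerve pullback_matrices)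
  qed
qed (simp_all add: nerve_def)

lemma edge_nerve:
  "\<lbrakk>m \<in> matrices n; i \<le> n; j \<le> n\<rbrakk>
    \<Longrightarrow> edge nerve n (enc n m) i j = enc 1 (pullback (edge_map i j) 1 m)"
  unfolding edge_def by (intro act_nerve edge_map_in)

lemma dec_edge_nerve:
  assumes "m \<in> matrices n" "i \<le> n" "j \<le> n"
  shows "dec 1 (edge nerve n (enc n m) i j) (0, 1) = m (i, j)"
proof -
  have "dec 1 (edge nerve n (enc n m) i j) = pullback (edge_map i j) 1 m"
    using assms by (simp add: edge_nerve dec_enc pullback_matrices edge_map_in del: One_nat_def)
  then show ?thesis
    by (simp add: pullback_def edge_map_def)
qed

lemma partial_group_nerve: "partial_group nerve"
proof (intro partial_group.intro partial_group_axioms.intro symmetric_set_nerve)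
  \<comment> \<open>Any coherent matrix on \<open>[2]\<close> shows that there is a vertex.\<close>
  obtain w where w: "coherent P 2 w"
    using ex_coherent_triangle[OF mult_one[OF one_closed]] by blast
  have "pullback (\<lambda>i \<in> {..0}. 0) 0 (\<lambda>(i, j) \<in> {..2} \<times> {..2}. w i j) \<in> matrices 0"
    by (intro pullback_matrices[OF matrices_2[OF w]]) auto
  moreover have "m = m'" if "m \<in> matrices 0" "m' \<in> matrices 0" for m m'
    using that by (rule matrices_eqI) simp
  ultimately obtain m where "matrices 0 = {m}"
    by blast
  then show "reduced nerve"
    by (simp add: reduced_def fob_nerve)
  show "spiny nerve"
    unfolding spiny_def
  proof (intro allI impI inj_onI)
    fix n :: nat and x y
    assume x: "x \<in> fob nerve n" and y: "y \<in> fob nerve n"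
      and eq: "segal_map nerve n x = segal_map nerve n y"
    obtain m m' where m: "m \<in> matrices n" "x = enc n m" and m': "m' \<in> matrices n" "y = enc n m'"
      using x y by (auto simp: fob_nerve)
    have "m (i, Suc i) = m' (i, Suc i)" if "i < n" for i
    proof -
      have "edge nerve n x i (Suc i) = edge nerve n y i (Suc i)"
        using segal_map_Suc[OF that, of nerve, symmetric] eq by simp
      then show ?thesis
        using dec_edge_nerve[OF m(1), of i "Suc i"] dec_edge_nerve[OF m'(1), of i "Suc i"] that m m'
        by simp
    qed
    then show "x = y"
      using matrices_eqI[OF m(1) m'(1)] m m' by simp
  qed
qed

lemma two_skeletal_nerve: "two_skeletal nerve"
  unfolding two_skeletal_iff[OF symmetric_set_nerve]
proof (intro allI ballI)
  fix n x assume "x \<in> fob nerve n"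
  then obtain m where m: "m \<in> matrices n" "x = enc n m" by (auto simp: fob_nerve)
  then obtain \<alpha> w where \<alpha>: "\<alpha> \<in> {..n} \<rightarrow>\<^sub>E {..2}" and w: "coherent P 2 w"
    and mw: "\<And>i j. \<lbrakk>i \<le> n; j \<le> n\<rbrakk> \<Longrightarrow> m (i, j) = w (\<alpha> i) (\<alpha> j)"
    by (auto simp: matrices_def)
  let ?w = "\<lambda>(i, j) \<in> {..2} \<times> {..2}. w i j"
  have "\<alpha> i \<le> 2" if "i \<le> n" for i using \<alpha> that by auto
  then have "pullback \<alpha> n ?w (i, j) = m (i, j)" if "i \<le> n" "j \<le> n" for i j
    using that by (simp add: pullback_def mw)
  then have "pullback \<alpha> n ?w = m"
    by (intro matrices_eqI[OF pullback_matrices[OF matrices_2[OF w] \<alpha>] m(1)]) simp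
  then show "\<exists>\<alpha> \<in> {..n} \<rightarrow>\<^sub>E {..2}. \<exists>y \<in> fob nerve 2. x = fmor nerve 2 n \<alpha> y"
    using \<alpha> matrices_2[OF w] m(2)
    by (intro bexI[of _ \<alpha>] bexI[of _ "enc 2 ?w"]) (simp_all add: act_nerve fob_nerve)
qed

text \<open>
  The isomorphism sends the code of a matrix on \<open>[1]\<close> to its entry \<open>(0, 1)\<close>. Coherent triangles
  give its surjectivity, applied to \<open>a 1 = a\<close>, and show that it reflects products.
\<close>

lemma edge_magma_nerve:
  "\<exists>h. isomorphism binary_partial_groups (edge_magma nerve) P h"
proof -
  interpret N: partial_group nerve by (rule partial_group_nerve)
  define h where "h = (\<lambda>x \<in> fob nerve 1. dec 1 x (0, 1))"
  have h_edge: "h (edge nerve n (enc n m) i j) = m (i, j)"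
    if "m \<in> matrices n" "i \<le> n" "j \<le> n" for n m i j
    using that dec_edge_nerve[OF that] N.edge_closed[of "enc n m" n i j]
    by (simp add: h_def fob_nerve)
  have h_inj: "inj_on h (fob nerve 1)"
  proof (rule inj_onI)
    fix x y assume xy: "x \<in> fob nerve 1" "y \<in> fob nerve 1" "h x = h y"
    then obtain m m' where m: "m \<in> matrices 1" "x = enc 1 m" "m' \<in> matrices 1" "y = enc 1 m'"
      by (auto simp: fob_nerve)
    then have "m (0, 1) = m' (0, 1)"
      using xy dec_enc[OF m(1)] dec_enc[OF m(3)] by (simp add: h_def)
    then have "m = m'"
      by (intro matrices_eqI[OF m(1,3)]) simp
    then show "x = y" using m by simp
  qed
  have h_closed: "h x \<in> pcarrier P" if "x \<in> fob nerve 1" for x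
    using that coherent_closed[OF coherent_matrices, of _ 1 0 1]
    by (auto simp: h_def fob_nerve dec_enc simp del: One_nat_def)
  have triangle: "\<exists>y \<in> fob nerve 2. h (edge nerve 2 y 0 1) = a \<and> h (edge nerve 2 y 1 2) = b \<and>
      h (edge nerve 2 y 0 2) = c" if ab: "pmult P a b = Some c" for a b c
  proof -
    obtain w where w: "coherent P 2 w" "w 0 1 = a" "w 1 2 = b" "w 0 2 = c"
      by (rule ex_coherent_triangle[OF ab])
    let ?w = "\<lambda>(i, j) \<in> {..2} \<times> {..2}. w i j"
    show ?thesis
      using matrices_2[OF w(1)] h_edge[OF matrices_2[OF w(1)]] w
      by (intro bexI[of _ "enc 2 ?w"]) (simp_all add: fob_nerve)
  qed
  have h_surj: "a \<in> h ` fob nerve 1" if a: "a \<in> pcarrier P" for a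
    using triangle[OF mult_one[OF a]] N.edge_closed[of _ 2 0 1] by auto
  have "isomorphism binary_partial_groups (edge_magma nerve) P h"
  proof (rule isomorphism_binary_partial_groups)
    show "h \<in> bpg_hom (edge_magma nerve) P"
      unfolding bpg_hom_def N.pcarrier_edge_magma
    proof (intro CollectI conjI ballI allI impI)
      show "h \<in> fob nerve 1 \<rightarrow>\<^sub>E pcarrier P"
        using h_closed by (auto simp: h_def)
      fix a b c assume "pmult (edge_magma nerve) a b = Some c"
      then obtain m where m: "m \<in> matrices 2" "edge nerve 2 (enc 2 m) 0 1 = a"
        "edge nerve 2 (enc 2 m) 1 2 = b" "edge nerve 2 (enc 2 m) 0 2 = c"
        by (auto simp: N.pmult_edge_magma fob_nerve)
      then show "pmult P (h a) (h b) = Some (h c)"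
        using h_edge[OF m(1), of 0 1] h_edge[OF m(1), of 1 2] h_edge[OF m(1), of 0 2]
          coherent_matrices[OF m(1)]
        by (simp add: coherent_def)
    qed
  next
    show "bij_betw h (pcarrier (edge_magma nerve)) (pcarrier P)"
      using h_inj h_closed h_surj by (auto simp: bij_betw_def N.pcarrier_edge_magma)
  next
    fix a b c
    assume abc: "a \<in> pcarrier (edge_magma nerve)" "b \<in> pcarrier (edge_magma nerve)"
      "c \<in> pcarrier (edge_magma nerve)" "pmult P (h a) (h b) = Some (h c)"
    obtain y where y: "y \<in> fob nerve 2" "h (edge nerve 2 y 0 1) = h a"
      "h (edge nerve 2 y 1 2) = h b" "h (edge nerve 2 y 0 2) = h c"
      using triangle[OF abc(4)] by blast
    then have "edge nerve 2 y 0 1 = a" "edge nerve 2 y 1 2 = b" "edge nerve 2 y 0 2 = c"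
      using abc(1-3) N.edge_closed[OF y(1)] h_inj
      by (auto simp: N.pcarrier_edge_magma dest: inj_onD)
    then show "pmult (edge_magma nerve) a b = Some c"
      using y(1) by (auto simp: N.pmult_edge_magma)
  qed (rule binary_partial_group_axioms)
  then show ?thesis by blast
qed

end

theorem theorem13:
  assumes "infinite (UNIV :: 'u set)"
  shows "equivalent_categories
    (two_skeletal_partial_groups :: ('u symset, nat \<Rightarrow> 'u \<Rightarrow> 'u) cat)
    (binary_partial_groups :: ('u partial_magma, 'u \<Rightarrow> 'u) cat)"
proof (rule equivalent_categories_if_fully_faithful_ess_surj[OF is_functor_edge_functor])
  fix X Y :: "'u symset" and f
  assume "X \<in> Ob two_skeletal_partial_groups" "Y \<in> Ob two_skeletal_partial_groups"
    "f \<in> Hom binary_partial_groups (fob edge_functor X) (fob edge_functor Y)"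
  then show "\<exists>t \<in> Hom two_skeletal_partial_groups X Y. fmor edge_functor X Y t = f"
    using edge_functor_full[of X Y f]
    by (auto simp: Ob_two_skeletal Hom_two_skeletal edge_functor_def binary_partial_groups_def)
next
  fix X Y :: "'u symset" and s t
  assume "X \<in> Ob two_skeletal_partial_groups" "Y \<in> Ob two_skeletal_partial_groups"
    "s \<in> Hom two_skeletal_partial_groups X Y" "t \<in> Hom two_skeletal_partial_groups X Y"
    "fmor edge_functor X Y s = fmor edge_functor X Y t"
  then show "s = t"
    using edge_functor_faithful[of X Y s t]
    by (auto simp: Ob_two_skeletal Hom_two_skeletal edge_functor_def)
next
  fix P :: "'u partial_magma"
  assume "P \<in> Ob binary_partial_groups"
  then have P: "binary_partial_group P" by (simp add: binary_partial_groups_def)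
  have "\<forall>n. \<exists>e :: (nat \<times> nat \<Rightarrow> 'u) \<Rightarrow> 'u. inj_on e ({..n} \<times> {..n} \<rightarrow>\<^sub>E UNIV)"
    by (intro allI ex_inj_on_functions assms) simp
  then obtain enc :: "nat \<Rightarrow> (nat \<times> nat \<Rightarrow> 'u) \<Rightarrow> 'u"
    where enc: "\<And>n. inj_on (enc n) ({..n} \<times> {..n} \<rightarrow>\<^sub>E UNIV)"
    by metis
  interpret encoded_nerve P enc
    using P enc by (simp add: encoded_nerve_def encoded_nerve_axioms_def)
  show "\<exists>X \<in> Ob two_skeletal_partial_groups.
      \<exists>h. isomorphism binary_partial_groups (fob edge_functor X) P h"
    using edge_magma_nerve partial_group_nerve two_skeletal_nerve
    by (intro bexI[of _ nerve]) (simp_all add: Ob_two_skeletal edge_functor_def)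
qed

end
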